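(* Let $\mathrm{H}:\mathbf{Top}_0\to\mathbf{Set}$ be an R-subset system having property M. Then $\mathbf{SH}\text{-}\mathbf{Sob}$ is reflective in $\mathbf{Top}_0$ and $\mathbf{SH}\text{-}\mathbf{Sob}$ is reflective in $\mathbf{H}\text{-}\mathbf{Sob}$. The functor $H^S:\mathbf{Top}_0\to\mathbf{SH}\text{-}\mathbf{Sob}$ is a left adjoint to the inclusion functor $I:\mathbf{SH}\text{-}\mathbf{Sob}\to\mathbf{Top}_0$, where for any continuous mapping $f:X\to Y$ in $\mathbf{Top}_0$, $H^S(X)=X^{H}=P_H(\mathrm{H}^D_c(X))$, $H^S(Y)=Y^{H}=P_H(\mathrm{H}^D_c(Y))$, and $H^S(f)=f^{H}:X^{H}\to Y^{H}$ is the unique continuous mapping such that $f^{H}\circ\eta_X^{H}=\eta_Y^{H}\circ f$. For each $A\in\mathrm{H}^D_c(X)$, $f^{H}(A)=\overline{f(A)}$.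
   Context: $\mathbf{Top}_0$ is the category of all $T_0$ spaces with continuous mappings. A subset $A$ of a space $X$ is irreducible if it is nonempty and whenever $A\subseteq F_1\cup F_2$ with $F_1,F_2$ closed in $X$, then $A\subseteq F_1$ or $A\subseteq F_2$. An R-subset system (irreducible subset system) is a covariant functor $\mathrm{H}:\mathbf{Top}_0\to\mathbf{Set}$ such that (i) for every $T_0$ space $X$, $\mathrm{H}(X)$ is a set of irreducible subsets of $X$ which contains all singletons $\{x\}$, $x\in X$; (ii) for every continuous mapping $f:X\to Y$ between $T_0$ spaces and every $A\in \mathrm{H}(X)$, $\mathrm{H}(f)(A)=f(A)\in \mathrm{H}(Y)$. A $T_0$ space $X$ is $\mathrm{H}$-sober if for every $A\in\mathrm{H}(X)$ there is a (necessarily unique) point $x\in X$ with $\overline{A}=\overline{\{x\}}$. The specialization order of a $T_0$ space $X$ is $x\le y$ iff $x\in\overline{\{y\}}$; $\mathord{\uparrow}A$ is the upper closure of $A$ in this order. A subset is saturated if it is an intersection of open sets (equivalently, an upper set). $\mathsf{K}(X)$ is the set of all nonempty compact saturated subsets of $X$. The Smyth power space $P_S(X)$ is $\mathsf{K}(X)$ with the topology having as base the sets $\Box U=\{K\in\mathsf{K}(X):K\subseteq U\}$, $U$ open in $X$ (it is a $T_0$ space). A $T_0$ space $X$ is super $\mathrm{H}$-sober if $P_S(X)$ is $\mathrm{H}$-sober. $\mathbf{H}\text{-}\mathbf{Sob}$ and $\mathbf{SH}\text{-}\mathbf{Sob}$ are the categories of all $\mathrm{H}$-sober spaces, respectively all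 super $\mathrm{H}$-sober spaces, with continuous mappings; $\mathbf{SH}\text{-}\mathbf{Sob}$ is a full subcategory of $\mathbf{H}\text{-}\mathbf{Sob}$. $\mathrm{H}$ has property M if for every $T_0$ space $X$, every $\mathcal K\in\mathrm{H}(P_S(X))$ and every closed $A\subseteq X$ with $K\cap A\neq\emptyset$ for all $K\in\mathcal K$, one has $\{\mathord{\uparrow}(K\cap A):K\in\mathcal K\}\in\mathrm{H}(P_S(X))$. A nonempty subset $A$ of a $T_0$ space $X$ is super $\mathrm{H}$-sober determined if for every continuous mapping $f:X\to Y$ to a super $\mathrm{H}$-sober space $Y$ there exists a unique $y_A\in Y$ with $\overline{f(A)}=\overline{\{y_A\}}$. $\mathrm{H}^D_c(X)$ is the set of all closed super $\mathrm{H}$-sober determined subsets of $X$. For a set $\mathcal G$ of subsets of $X$, $P_H(\mathcal G)$ is $\mathcal G$ with the lower Vietoris topology, which has the sets $\Diamond U=\{G\in\mathcal G:G\cap U\ne\emptyset\}$, $U$ open in $X$, as a subbase. The canonical mapping $\eta_X^{H}:X\to P_H(\mathrm{H}^D_c(X))$ is $\eta_X^{H}(x)=\overline{\{x\}}$. *)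

theory Defs
  imports "HOL-Analysis.Analysis"
begin

section \<open>A universe of sets\<close>

text \<open>
  A type cannot carry all sets, so ``all $T_0$ spaces'' means all $T_0$ spaces in a Grothendieck
  universe. The elements of the type are the sets of the universe, \<open>elts x\<close> is the set of members
  of \<open>x\<close>, and transitivity of the universe is built into the typing of \<open>elts\<close>. The axioms are the
  usual ones (pairing, power sets, unions of families indexed by a member); the axiom \<open>power\<close> says
  that the members of the power set represent exactly the subsets of \<open>elts x\<close>.
  No axiom of infinity is imposed, so the hereditarily finite sets are also admitted.
\<close>

class grothendieck_universe =
  fixes elts :: "'a \<Rightarrow> 'a set"
  assumes elts_inject: "elts x = elts y \<Longrightarrow> x = y"
    and pairing: "\<exists>z. elts z = {x, y}"
    and power: "\<exists>z. elts ` elts z = Pow (elts x)"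
    and union: "\<exists>z. elts z = (\<Union>i\<in>elts x. elts (f i))"

definition small :: "'u::grothendieck_universe set \<Rightarrow> bool" where
  "small A \<longleftrightarrow> A \<in> range elts"

text \<open>The element of the universe representing a small set.\<close>

definition as_elt :: "'u::grothendieck_universe set \<Rightarrow> 'u" where
  "as_elt = inv elts"

lemma elts_as_elt: "small A \<Longrightarrow> elts (as_elt A) = A"
  by (simp add: small_def as_elt_def f_inv_into_f)

lemma small_subset:
  assumes "small A" and "B \<subseteq> A"
  shows "small B"
proof -
  obtain x where x: "A = elts x"
    using assms(1) unfolding small_def by auto
  obtain z where "elts ` elts z = Pow (elts x)"
    using power[of x] by auto
  then have "B \<in> elts ` elts z"
    using assms(2) x by simp
  then show ?thesis
    unfolding small_def by auto
qed


section \<open>Categories, functors, adjunctions\<close>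

text \<open>
  Hom-sets are not required to be disjoint; therefore composition and the arrow part of a functor
  take the objects as arguments: for \<open>f \<in> Hom C X Y\<close> and \<open>g \<in> Hom C Y Z\<close>, the composite of
  \<open>g\<close> after \<open>f\<close> is \<open>Comp C X Y Z g f\<close>.
\<close>

record ('o, 'm) cat =
  Obj :: "'o set"
  Hom :: "'o \<Rightarrow> 'o \<Rightarrow> 'm set"
  Ident :: "'o \<Rightarrow> 'm"
  Comp :: "'o \<Rightarrow> 'o \<Rightarrow> 'o \<Rightarrow> 'm \<Rightarrow> 'm \<Rightarrow> 'm"

definition category :: "('o, 'm) cat \<Rightarrow> bool" where
  "category C \<longleftrightarrow>
    (\<forall>X\<in>Obj C. Ident C X \<in> Hom C X X) \<and>
    (\<forall>X\<in>Obj C. \<forall>Y\<in>Obj C. \<forall>Z\<in>Obj C. \<forall>f\<in>Hom C X Y. \<forall>g\<in>Hom C Y Z.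
       Comp C X Y Z g f \<in> Hom C X Z) \<and>
    (\<forall>X\<in>Obj C. \<forall>Y\<in>Obj C. \<forall>f\<in>Hom C X Y.
       Comp C X X Y f (Ident C X) = f \<and> Comp C X Y Y (Ident C Y) f = f) \<and>
    (\<forall>W\<in>Obj C. \<forall>X\<in>Obj C. \<forall>Y\<in>Obj C. \<forall>Z\<in>Obj C.
       \<forall>f\<in>Hom C W X. \<forall>g\<in>Hom C X Y. \<forall>h\<in>Hom C Y Z.
       Comp C W Y Z h (Comp C W X Y g f) = Comp C W X Z (Comp C X Y Z h g) f)"

record ('o, 'm, 'p, 'n) func =
  fobj :: "'o \<Rightarrow> 'p"
  farr :: "'o \<Rightarrow> 'o \<Rightarrow> 'm \<Rightarrow> 'n"

definition is_functor ::
  "('o, 'm) cat \<Rightarrow> ('p, 'n) cat \<Rightarrow> ('o, 'm, 'p, 'n) func \<Rightarrow> bool" where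
  "is_functor C D F \<longleftrightarrow>
    category C \<and> category D \<and>
    (\<forall>X\<in>Obj C. fobj F X \<in> Obj D) \<and>
    (\<forall>X\<in>Obj C. \<forall>Y\<in>Obj C. \<forall>f\<in>Hom C X Y. farr F X Y f \<in> Hom D (fobj F X) (fobj F Y)) \<and>
    (\<forall>X\<in>Obj C. farr F X X (Ident C X) = Ident D (fobj F X)) \<and>
    (\<forall>X\<in>Obj C. \<forall>Y\<in>Obj C. \<forall>Z\<in>Obj C. \<forall>f\<in>Hom C X Y. \<forall>g\<in>Hom C Y Z.
       farr F X Z (Comp C X Y Z g f) =
       Comp D (fobj F X) (fobj F Y) (fobj F Z) (farr F Y Z g) (farr F X Y f))"

text \<open>\<open>F : C \<rightarrow> D\<close> is left adjoint to \<open>G : D \<rightarrow> C\<close>: there are bijections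
  \<open>Hom D (F X) Y \<cong> Hom C X (G Y)\<close>, natural in \<open>X\<close> and \<open>Y\<close>.\<close>

definition left_adjoint ::
  "('o, 'm) cat \<Rightarrow> ('p, 'n) cat \<Rightarrow> ('o, 'm, 'p, 'n) func \<Rightarrow> ('p, 'n, 'o, 'm) func \<Rightarrow> bool" where
  "left_adjoint C D F G \<longleftrightarrow>
    is_functor C D F \<and> is_functor D C G \<and>
    (\<exists>\<phi>.
      (\<forall>X\<in>Obj C. \<forall>Y\<in>Obj D. bij_betw (\<phi> X Y) (Hom D (fobj F X) Y) (Hom C X (fobj G Y))) \<and>
      (\<forall>X\<in>Obj C. \<forall>X'\<in>Obj C. \<forall>Y\<in>Obj D. \<forall>Y'\<in>Obj D.
       \<forall>h\<in>Hom C X' X. \<forall>k\<in>Hom D Y Y'. \<forall>g\<in>Hom D (fobj F X) Y.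
         \<phi> X' Y' (Comp D (fobj F X') Y Y' k (Comp D (fobj F X') (fobj F X) Y g (farr F X' X h))) =
         Comp C X' (fobj G Y) (fobj G Y') (farr G Y Y' k)
           (Comp C X' X (fobj G Y) (\<phi> X Y g) h)))"

definition full_subcategory :: "('o, 'm) cat \<Rightarrow> ('o, 'm) cat \<Rightarrow> bool" where
  "full_subcategory D C \<longleftrightarrow>
    category D \<and> category C \<and> Obj D \<subseteq> Obj C \<and>
    (\<forall>X\<in>Obj D. Ident D X = Ident C X) \<and>
    (\<forall>X\<in>Obj D. \<forall>Y\<in>Obj D. Hom D X Y = Hom C X Y) \<and>
    (\<forall>X\<in>Obj D. \<forall>Y\<in>Obj D. \<forall>Z\<in>Obj D. \<forall>f\<in>Hom D X Y. \<forall>g\<in>Hom D Y Z.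
       Comp D X Y Z g f = Comp C X Y Z g f)"

definition inclusion :: "('o, 'm, 'o, 'm) func" where
  "inclusion = \<lparr>fobj = (\<lambda>X. X), farr = (\<lambda>X Y f. f)\<rparr>"

definition reflective :: "('o, 'm) cat \<Rightarrow> ('o, 'm) cat \<Rightarrow> bool" where
  "reflective D C \<longleftrightarrow> full_subcategory D C \<and> (\<exists>F. left_adjoint C D F inclusion)"


section \<open>The categories of sets and of $T_0$ spaces\<close>

text \<open>Functions are made extensional so that equality of morphisms is equality of functions on the
  domain.\<close>

definition Set_cat :: "('a set, 'a \<Rightarrow> 'a) cat" where
  "Set_cat = \<lparr>Obj = UNIV, Hom = (\<lambda>A B. A \<rightarrow>\<^sub>E B), Ident = (\<lambda>A. \<lambda>x\<in>A. x),
              Comp = (\<lambda>A B C g f. compose A g f)\<rparr>"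

definition Top0 :: "('u::grothendieck_universe topology, 'u \<Rightarrow> 'u) cat" where
  "Top0 = \<lparr>Obj = {X. t0_space X \<and> small (topspace X)},
           Hom = (\<lambda>X Y. {f. continuous_map X Y f \<and> f \<in> extensional (topspace X)}),
           Ident = (\<lambda>X. \<lambda>x\<in>topspace X. x),
           Comp = (\<lambda>X Y Z g f. compose (topspace X) g f)\<rparr>"

lemma category_Set_cat: "category Set_cat"
  unfolding category_def Set_cat_def
  by (auto simp: compose_def restrict_def fun_eq_iff PiE_def Pi_def extensional_def)

lemma category_Top0: "category (Top0 :: ('u::grothendieck_universe topology, 'u \<Rightarrow> 'u) cat)"
proof -
  have 1: "continuous_map X X (\<lambda>x\<in>topspace X. x)" for X :: "'u topology"
    by (rule continuous_map_eq[OF continuous_map_id]) auto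
  have 2: "continuous_map X Z (compose (topspace X) g f)"
    if "continuous_map X Y f" "continuous_map Y Z g" for X Y Z :: "'u topology" and f g
    by (rule continuous_map_eq[OF continuous_map_compose[OF that]]) (simp add: compose_def)
  show ?thesis
    unfolding category_def Top0_def
    by (auto simp: 1 2 compose_def fun_eq_iff extensional_def
        intro: continuous_map_compose[unfolded o_def] dest: continuous_map_image_subset_topspace)
qed


section \<open>$R$-subset systems and $H$-sober spaces\<close>

definition irreducible_in :: "'a topology \<Rightarrow> 'a set \<Rightarrow> bool" where
  "irreducible_in X A \<longleftrightarrow> A \<subseteq> topspace X \<and> A \<noteq> {} \<and>
    (\<forall>F1 F2. closedin X F1 \<longrightarrow> closedin X F2 \<longrightarrow> A \<subseteq> F1 \<union> F2 \<longrightarrow> A \<subseteq> F1 \<or> A \<subseteq> F2)"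

type_synonym 'u subset_system = "('u topology, 'u \<Rightarrow> 'u, 'u set set, 'u set \<Rightarrow> 'u set) func"

definition R_subset_system :: "'u::grothendieck_universe subset_system \<Rightarrow> bool" where
  "R_subset_system H \<longleftrightarrow>
    is_functor Top0 Set_cat H \<and>
    (\<forall>X\<in>Obj Top0. (\<forall>A\<in>fobj H X. irreducible_in X A) \<and> (\<forall>x\<in>topspace X. {x} \<in> fobj H X)) \<and>
    (\<forall>X\<in>Obj Top0. \<forall>Y\<in>Obj Top0. \<forall>f\<in>Hom Top0 X Y. \<forall>A\<in>fobj H X.
       farr H X Y f A = f ` A \<and> f ` A \<in> fobj H Y)"

definition H_sober :: "'u::grothendieck_universe subset_system \<Rightarrow> 'u topology \<Rightarrow> bool" where
  "H_sober H X \<longleftrightarrow> X \<in> Obj Top0 \<and>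
    (\<forall>A\<in>fobj H X. \<exists>x\<in>topspace X. X closure_of A = X closure_of {x})"


section \<open>Smyth power spaces and super $H$-sober spaces\<close>

definition saturated_in :: "'a topology \<Rightarrow> 'a set \<Rightarrow> bool" where
  "saturated_in X A \<longleftrightarrow> (\<exists>\<U>. (\<forall>U\<in>\<U>. openin X U) \<and> A = topspace X \<inter> \<Inter>\<U>)"

definition spec_le :: "'a topology \<Rightarrow> 'a \<Rightarrow> 'a \<Rightarrow> bool" where
  "spec_le X x y \<longleftrightarrow> x \<in> topspace X \<and> y \<in> topspace X \<and> x \<in> X closure_of {y}"

definition up_closure :: "'a topology \<Rightarrow> 'a set \<Rightarrow> 'a set" where
  "up_closure X A = {y. \<exists>x\<in>A. spec_le X x y}"

definition compact_saturated :: "'a topology \<Rightarrow> 'a set set" where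
  "compact_saturated X = {K. K \<noteq> {} \<and> compactin X K \<and> saturated_in X K}"

text \<open>The points of the Smyth power space are the elements of the universe that represent nonempty
  compact saturated sets. The sets \<open>\<box>U\<close> are closed under finite intersections
  (\<open>\<box>U \<inter> \<box>V = \<box>(U \<inter> V)\<close>), so they form a base of the topology they generate.\<close>

definition smyth :: "'u::grothendieck_universe topology \<Rightarrow> 'u topology" where
  "smyth X = topology_generated_by
     {{k. elts k \<in> compact_saturated X \<and> elts k \<subseteq> U} | U. openin X U}"

definition super_H_sober :: "'u::grothendieck_universe subset_system \<Rightarrow> 'u topology \<Rightarrow> bool" where
  "super_H_sober H X \<longleftrightarrow> X \<in> Obj Top0 \<and> H_sober H (smyth X)"

definition H_Sob ::
  "'u::grothendieck_universe subset_system \<Rightarrow> ('u topology, 'u \<Rightarrow> 'u) cat" where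
  "H_Sob H = Top0\<lparr>Obj := {X. H_sober H X}\<rparr>"

definition SH_Sob ::
  "'u::grothendieck_universe subset_system \<Rightarrow> ('u topology, 'u \<Rightarrow> 'u) cat" where
  "SH_Sob H = Top0\<lparr>Obj := {X. super_H_sober H X}\<rparr>"

definition property_M :: "'u::grothendieck_universe subset_system \<Rightarrow> bool" where
  "property_M H \<longleftrightarrow>
    (\<forall>X\<in>Obj Top0. \<forall>\<K>\<in>fobj H (smyth X). \<forall>A.
       closedin X A \<longrightarrow> (\<forall>k\<in>\<K>. elts k \<inter> A \<noteq> {}) \<longrightarrow>
       (\<lambda>k. as_elt (up_closure X (elts k \<inter> A))) ` \<K> \<in> fobj H (smyth X))"


section \<open>The super $H$-sober reflection\<close>

definition super_H_sober_determined ::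
  "'u::grothendieck_universe subset_system \<Rightarrow> 'u topology \<Rightarrow> 'u set \<Rightarrow> bool" where
  "super_H_sober_determined H X A \<longleftrightarrow> A \<subseteq> topspace X \<and> A \<noteq> {} \<and>
    (\<forall>Y f. super_H_sober H Y \<longrightarrow> continuous_map X Y f \<longrightarrow>
       (\<exists>!y. y \<in> topspace Y \<and> Y closure_of (f ` A) = Y closure_of {y}))"

definition HDc :: "'u::grothendieck_universe subset_system \<Rightarrow> 'u topology \<Rightarrow> 'u set set" where
  "HDc H X = {A. closedin X A \<and> super_H_sober_determined H X A}"

text \<open>\<open>P_H X \<G>\<close> is \<open>\<G>\<close> with the lower Vietoris topology, its points being represented by elements
  of the universe. The whole set \<open>\<G>\<close> is added to the subbase so that it is the underlying set of
  the space even if \<open>{} \<in> \<G>\<close>.\<close>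

definition P_H :: "'u::grothendieck_universe topology \<Rightarrow> 'u set set \<Rightarrow> 'u topology" where
  "P_H X \<G> = topology_generated_by
     (insert {g. elts g \<in> \<G>} {{g. elts g \<in> \<G> \<and> elts g \<inter> U \<noteq> {}} | U. openin X U})"

definition XH :: "'u::grothendieck_universe subset_system \<Rightarrow> 'u topology \<Rightarrow> 'u topology" where
  "XH H X = P_H X (HDc H X)"

definition eta :: "'u::grothendieck_universe topology \<Rightarrow> 'u \<Rightarrow> 'u" where
  "eta X = (\<lambda>x\<in>topspace X. as_elt (X closure_of {x}))"

definition HS :: "'u::grothendieck_universe subset_system \<Rightarrow>
    ('u topology, 'u \<Rightarrow> 'u, 'u topology, 'u \<Rightarrow> 'u) func" where
  "HS H = \<lparr>fobj = XH H,
           farr = (\<lambda>X Y f. THE g. g \<in> Hom Top0 (XH H X) (XH H Y) \<and>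
             Comp Top0 X (XH H X) (XH H Y) g (eta X) = Comp Top0 X Y (XH H Y) (eta Y) f)\<rparr>"

end

theory Submission
  imports Defs
begin

text \<open>
  The points of the reflection \<open>X\<^sup>H\<close> are the closed sets that no map into a super \<open>H\<close>-sober space can
  tell from a point closure: a continuous map \<open>f : X \<rightarrow> Y\<close> with \<open>Y\<close> super \<open>H\<close>-sober sends a determined set \<open>A\<close>
  to a set with a generic point \<open>y\<^sub>A\<close>, and \<open>A \<mapsto> y\<^sub>A\<close> is the extension of \<open>f\<close> to \<open>X\<^sup>H\<close>. Determined
  sets are irreducible (\<open>determined_meets_Int\<close>), so the open sets of \<open>X\<^sup>H\<close> are exactly the sets
  \<open>\<diamond>U\<close> (\<open>openin_XH_iff\<close>), and \<open>X\<^sup>H\<close> has the same lattice of open sets as \<open>X\<close>. This makes the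
  extension continuous (\<open>XH_lift_exists\<close>) and unique (\<open>XH_hom_eqI\<close>).

  It remains to see that \<open>X\<^sup>H\<close> is super \<open>H\<close>-sober. Let \<open>Z\<close> be any \<open>T\<^sub>0\<close> space and
  \<open>\<K> \<in> H(P\<^sub>S Z)\<close>. A closed set that is minimal among those meeting all members of \<open>\<K>\<close> is determined; this is where property M
  enters (\<open>minimal_closed_determined\<close>). Such minimal sets exist below every closed set that meets
  all members, by compactness and Zorn's lemma. Consequently a \<open>T\<^sub>0\<close> space in which every closed
  determined set has a generic point is super \<open>H\<close>-sober (\<open>super_H_soberI\<close>): the generic compact set
  of \<open>\<K>\<close> is the intersection of all open sets that include a member of \<open>\<K>\<close>. The space \<open>X\<^sup>H\<close>
  satisfies this condition, because a closed determined set of \<open>X\<^sup>H\<close> pulls back along \<open>\<eta>\<close> to a closed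
  determined set of \<open>X\<close>, that is, to a point of \<open>X\<^sup>H\<close> (\<open>XH_super_H_sober\<close>).

  The universal property of \<open>\<eta>\<close> yields functoriality and the adjunction. Every super \<open>H\<close>-sober space
  is \<open>H\<close>-sober, so the adjunction restricts to the \<open>H\<close>-sober spaces.
\<close>

section \<open>Small sets\<close>

lemma elts_eq_iff: "elts x = elts y \<longleftrightarrow> x = y"
  using elts_inject by blast

lemma small_Pow:
  assumes "small A"
  shows "small {k. elts k \<subseteq> A}"
proof -
  obtain x where x: "A = elts x"
    using assms unfolding small_def by auto
  obtain z where z: "elts ` elts z = Pow (elts x)"
    using power[of x] by auto
  have "{k. elts k \<subseteq> A} = elts z"
  proof (intro equalityI subsetI)
    fix k assume "k \<in> {k. elts k \<subseteq> A}"
    then have "elts k \<in> elts ` elts z"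
      using z x by simp
    then show "k \<in> elts z"
      by (auto simp: elts_eq_iff)
  next
    fix k assume "k \<in> elts z"
    then show "k \<in> {k. elts k \<subseteq> A}"
      using z x by blast
  qed
  then show ?thesis
    by (simp add: small_def)
qed

text \<open>Two points suffice later to build, as a power set, a four-point test space.\<close>

lemma small_two_points: "\<exists>p q :: 'u::grothendieck_universe. p \<noteq> q \<and> small {p, q}"
proof -
  fix a :: 'u
  obtain z where z: "elts ` elts z = Pow (elts a)"
    using power[of a] by auto
  then have "{} \<in> elts ` elts z"
    by simp
  then obtain p :: 'u where p: "elts p = {}"
    by (metis imageE)
  obtain q where q: "elts q = {p, p}"
    using pairing[of p p] by auto
  obtain r where "elts r = {p, q}"
    using pairing[of p q] by auto
  moreover have "p \<noteq> q"
    using p q by auto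
  ultimately show ?thesis
    unfolding small_def by blast
qed


section \<open>Closures and saturations seen through open sets\<close>

lemma Obj_Top0: "X \<in> Obj Top0 \<longleftrightarrow> t0_space X \<and> small (topspace X)"
  by (simp add: Top0_def)

lemma Hom_Top0: "f \<in> Hom Top0 X Y \<longleftrightarrow> continuous_map X Y f \<and> f \<in> extensional (topspace X)"
  by (simp add: Top0_def)

lemma Comp_Top0: "Comp Top0 X Y Z g f = compose (topspace X) g f"
  by (simp add: Top0_def)

lemma restrict_in_Hom:
  assumes "continuous_map X Y f"
  shows "restrict f (topspace X) \<in> Hom Top0 X Y"
  using assms by (auto simp: Hom_Top0 intro: continuous_map_eq)

lemma small_subset_topspace:
  assumes "X \<in> Obj Top0" and "A \<subseteq> topspace X"
  shows "small A"
  using assms small_subset by (auto simp: Obj_Top0)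

text \<open>Generic points are found below by comparing the open sets that two sets meet.\<close>

lemma closure_eq_iff_meet_same_opens:
  assumes "A \<subseteq> topspace X" and "B \<subseteq> topspace X"
  shows "X closure_of A = X closure_of B \<longleftrightarrow>
    (\<forall>U. openin X U \<longrightarrow> (A \<inter> U \<noteq> {} \<longleftrightarrow> B \<inter> U \<noteq> {}))" (is "?L \<longleftrightarrow> ?R")
proof
  assume ?L
  then show ?R
    using openin_Int_closure_of_eq_empty by (metis Int_commute)
next
  assume ?R
  then have "(\<exists>y. y \<in> A \<and> y \<in> U) \<longleftrightarrow> (\<exists>y. y \<in> B \<and> y \<in> U)" if "openin X U" for U
    using that by (simp add: disjoint_iff)
  then show ?L
    by (auto simp: set_eq_iff in_closure_of)
qed

lemma openin_compl_closure_of: "openin X (topspace X - X closure_of A)"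
  by (rule openin_diff[OF openin_topspace closedin_closure_of])

lemma t0_closure_of_singleton_inject:
  assumes "t0_space X" "x \<in> topspace X" "y \<in> topspace X"
    and "X closure_of {x} = X closure_of {y}"
  shows "x = y"
  using assms by (metis t0_space_closure_of_sing)

lemma closure_of_image_closure_of:
  assumes "continuous_map X Y f" and "A \<subseteq> topspace X"
  shows "Y closure_of (f ` (X closure_of A)) = Y closure_of (f ` A)"
proof (rule antisym)
  show "Y closure_of (f ` (X closure_of A)) \<subseteq> Y closure_of (f ` A)"
    using assms by (simp add: closure_of_minimal continuous_map_image_closure_subset)
  show "Y closure_of (f ` A) \<subseteq> Y closure_of (f ` (X closure_of A))"
    using assms by (intro closure_of_mono image_mono closure_of_subset)
qed

lemma up_closure_subset_open_iff:
  assumes "A \<subseteq> topspace X" and "openin X U"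
  shows "up_closure X A \<subseteq> U \<longleftrightarrow> A \<subseteq> U"
proof
  assume "up_closure X A \<subseteq> U"
  moreover have "A \<subseteq> up_closure X A"
    using assms(1) closure_of_subset[of _ X]
    unfolding up_closure_def spec_le_def by blast
  ultimately show "A \<subseteq> U"
    by blast
next
  assume "A \<subseteq> U"
  then show "up_closure X A \<subseteq> U"
    using assms(2) unfolding up_closure_def spec_le_def in_closure_of by blast
qed

lemma up_closure_eq_Inter_opens:
  assumes "A \<subseteq> topspace X"
  shows "up_closure X A = topspace X \<inter> \<Inter>{U. openin X U \<and> A \<subseteq> U}"
proof (intro equalityI subsetI)
  fix y assume "y \<in> up_closure X A"
  then show "y \<in> topspace X \<inter> \<Inter>{U. openin X U \<and> A \<subseteq> U}"
    using up_closure_subset_open_iff[OF assms] by (auto simp: up_closure_def spec_le_def; blast)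
next
  fix y assume y: "y \<in> topspace X \<inter> \<Inter>{U. openin X U \<and> A \<subseteq> U}"
  show "y \<in> up_closure X A"
  proof (rule ccontr)
    \<comment> \<open>In that case the complement of the closure of \<open>y\<close> is an open neighbourhood of \<open>A\<close>.\<close>
    assume "y \<notin> up_closure X A"
    then have "A \<subseteq> topspace X - X closure_of {y}"
      using assms y unfolding up_closure_def spec_le_def by blast
    moreover have "openin X (topspace X - X closure_of {y})"
      by (rule openin_compl_closure_of)
    ultimately have "y \<in> topspace X - X closure_of {y}"
      using y by blast
    moreover have "y \<in> X closure_of {y}"
      using y closure_of_subset[of "{y}" X] by auto
    ultimately show False
      by blast
  qed
qed

lemma up_closure_compact_saturated:
  assumes "compactin X A" and "A \<noteq> {}"
  shows "up_closure X A \<in> compact_saturated X"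
proof -
  have A: "A \<subseteq> topspace X"
    using assms(1) by (rule compactin_subset_topspace)
  have eq: "up_closure X A = topspace X \<inter> \<Inter>{U. openin X U \<and> A \<subseteq> U}"
    by (rule up_closure_eq_Inter_opens[OF A])
  have "compactin X (up_closure X A)"
    unfolding compactin_def
  proof (intro conjI allI impI)
    show "up_closure X A \<subseteq> topspace X"
      using eq by blast
    fix \<U> assume \<U>: "Ball \<U> (openin X) \<and> up_closure X A \<subseteq> \<Union>\<U>"
    then have "A \<subseteq> \<Union>\<U>"
      using up_closure_subset_open_iff[OF A] by (meson openin_Union)
    then obtain \<F> where \<F>: "finite \<F>" "\<F> \<subseteq> \<U>" "A \<subseteq> \<Union>\<F>"
      using assms(1) \<U> unfolding compactin_def by meson
    then have "up_closure X A \<subseteq> \<Union>\<F>"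
      using up_closure_subset_open_iff[OF A] \<U> by (meson openin_Union subsetD)
    with \<F> show "\<exists>\<F>. finite \<F> \<and> \<F> \<subseteq> \<U> \<and> up_closure X A \<subseteq> \<Union>\<F>"
      by blast
  qed
  moreover have "saturated_in X (up_closure X A)"
    unfolding saturated_in_def eq by (intro exI[of _ "{U. openin X U \<and> A \<subseteq> U}"]) simp
  moreover have "up_closure X A \<noteq> {}"
    using up_closure_subset_open_iff[OF A, of "{}"] assms(2) by auto
  ultimately show ?thesis
    by (simp add: compact_saturated_def)
qed

lemma compact_saturated_subset: "K \<in> compact_saturated X \<Longrightarrow> K \<subseteq> topspace X"
  by (auto simp: compact_saturated_def dest: compactin_subset_topspace)


section \<open>The Smyth power space\<close>

lemma topspace_smyth: "topspace (smyth X) = {k. elts k \<in> compact_saturated X}"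
  unfolding smyth_def topology_generated_by_topspace
  using compact_saturated_subset[of _ X] by blast

lemma openin_smyth_box:
  "openin X U \<Longrightarrow> openin (smyth X) {k. elts k \<in> compact_saturated X \<and> elts k \<subseteq> U}"
  unfolding smyth_def by (rule topology_generated_by_Basis) blast

lemma openin_smyth_base:
  assumes "openin (smyth X) W" and "k \<in> W"
  shows "\<exists>U. openin X U \<and> elts k \<subseteq> U \<and> {l. elts l \<in> compact_saturated X \<and> elts l \<subseteq> U} \<subseteq> W"
proof -
  have "generate_topology_on {{k. elts k \<in> compact_saturated X \<and> elts k \<subseteq> U} | U. openin X U} W"
    using assms(1) unfolding smyth_def openin_topology_generated_by_iff .
  then have "\<forall>k\<in>W. \<exists>U. openin X U \<and> elts k \<subseteq> U \<and>
      {l. elts l \<in> compact_saturated X \<and> elts l \<subseteq> U} \<subseteq> W"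
  proof induction
    case (Int a b)
    show ?case
    proof
      fix k assume "k \<in> a \<inter> b"
      then obtain U V where "openin X U" "elts k \<subseteq> U"
        "{l. elts l \<in> compact_saturated X \<and> elts l \<subseteq> U} \<subseteq> a"
        "openin X V" "elts k \<subseteq> V" "{l. elts l \<in> compact_saturated X \<and> elts l \<subseteq> V} \<subseteq> b"
        using Int.IH by (meson IntE)
      then show "\<exists>U. openin X U \<and> elts k \<subseteq> U \<and>
          {l. elts l \<in> compact_saturated X \<and> elts l \<subseteq> U} \<subseteq> a \<inter> b"
        by (intro exI[of _ "U \<inter> V"]) auto
    qed
  next
    case (UN \<W>)
    show ?case
    proof
      fix k assume "k \<in> \<Union>\<W>"
      then obtain w where "w \<in> \<W>" "k \<in> w"
        by blast
      then show "\<exists>U. openin X U \<and> elts k \<subseteq> U \<and>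
          {l. elts l \<in> compact_saturated X \<and> elts l \<subseteq> U} \<subseteq> \<Union>\<W>"
        using UN.IH by (meson Union_upper subset_trans)
    qed
  qed auto
  then show ?thesis
    using assms(2) by blast
qed

lemma continuous_map_into_smyth:
  assumes "\<And>x. x \<in> topspace X \<Longrightarrow> elts (f x) \<in> compact_saturated Y"
    and "\<And>V. openin Y V \<Longrightarrow> openin X {x \<in> topspace X. elts (f x) \<subseteq> V}"
  shows "continuous_map X (smyth Y) f"
  unfolding smyth_def
proof (rule continuous_on_generated_topo)
  fix W assume "W \<in> {{k. elts k \<in> compact_saturated Y \<and> elts k \<subseteq> V} |V. openin Y V}"
  then obtain V where V: "openin Y V" "W = {k. elts k \<in> compact_saturated Y \<and> elts k \<subseteq> V}"
    by blast
  have "f -` W \<inter> topspace X = {x \<in> topspace X. elts (f x) \<subseteq> V}"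
    using assms(1) V(2) by blast
  then show "openin X (f -` W \<inter> topspace X)"
    using assms(2)[OF V(1)] by simp
next
  have "f ` topspace X \<subseteq> topspace (smyth Y)"
    using assms(1) by (auto simp: topspace_smyth)
  then show "f ` topspace X \<subseteq> \<Union>{{k. elts k \<in> compact_saturated Y \<and> elts k \<subseteq> V} |V. openin Y V}"
    by (simp only: smyth_def topology_generated_by_topspace)
qed

text \<open>Since the boxes form a base, they suffice to test whether \<open>q\<close> is generic for \<open>\<K>\<close>.\<close>

lemma smyth_closure_eq_iff:
  assumes "\<K> \<subseteq> topspace (smyth X)" and "q \<in> topspace (smyth X)"
  shows "smyth X closure_of \<K> = smyth X closure_of {q} \<longleftrightarrow>
    (\<forall>U. openin X U \<longrightarrow> ((\<exists>k\<in>\<K>. elts k \<subseteq> U) \<longleftrightarrow> elts q \<subseteq> U))" (is "?L \<longleftrightarrow> ?R")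
proof -
  have "?L \<longleftrightarrow> (\<forall>W. openin (smyth X) W \<longrightarrow> (\<K> \<inter> W \<noteq> {} \<longleftrightarrow> {q} \<inter> W \<noteq> {}))"
    using assms by (intro closure_eq_iff_meet_same_opens) auto
  also have "\<dots> \<longleftrightarrow> ?R"
  proof (rule iffI; intro allI impI)
    fix U assume *: "\<forall>W. openin (smyth X) W \<longrightarrow> (\<K> \<inter> W \<noteq> {} \<longleftrightarrow> {q} \<inter> W \<noteq> {})"
      and U: "openin X U"
    show "(\<exists>k\<in>\<K>. elts k \<subseteq> U) \<longleftrightarrow> elts q \<subseteq> U"
      using *[rule_format, OF openin_smyth_box[OF U]] assms unfolding topspace_smyth by blast
  next
    fix W assume R: ?R and W: "openin (smyth X) W"
    show "\<K> \<inter> W \<noteq> {} \<longleftrightarrow> {q} \<inter> W \<noteq> {}"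
    proof
      assume "\<K> \<inter> W \<noteq> {}"
      then obtain k where k: "k \<in> \<K>" "k \<in> W"
        by blast
      obtain U where U: "openin X U" "elts k \<subseteq> U"
        "{l. elts l \<in> compact_saturated X \<and> elts l \<subseteq> U} \<subseteq> W"
        using openin_smyth_base[OF W k(2)] by blast
      then have "elts q \<subseteq> U"
        using R k(1) by blast
      then show "{q} \<inter> W \<noteq> {}"
        using U(3) assms(2) unfolding topspace_smyth by blast
    next
      assume "{q} \<inter> W \<noteq> {}"
      then have "q \<in> W"
        by blast
      then obtain U where U: "openin X U" "elts q \<subseteq> U"
        "{l. elts l \<in> compact_saturated X \<and> elts l \<subseteq> U} \<subseteq> W"
        using openin_smyth_base[OF W] by blast
      then obtain k where "k \<in> \<K>" "elts k \<subseteq> U"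
        using R by blast
      then show "\<K> \<inter> W \<noteq> {}"
        using U(3) assms(1) unfolding topspace_smyth by blast
    qed
  qed
  finally show ?thesis .
qed

lemma smyth_in_Top0:
  assumes X: "X \<in> Obj Top0"
  shows "smyth X \<in> Obj Top0"
proof -
  have "small (topspace (smyth X))"
  proof (rule small_subset)
    show "small {k. elts k \<subseteq> topspace X}"
      using X by (simp add: small_Pow Obj_Top0)
    show "topspace (smyth X) \<subseteq> {k. elts k \<subseteq> topspace X}"
      by (auto simp: topspace_smyth dest: compact_saturated_subset)
  qed
  moreover have "t0_space (smyth X)"
    unfolding t0_space_closure_of_sing
  proof (intro ballI impI)
    fix k l assume k: "k \<in> topspace (smyth X)" and l: "l \<in> topspace (smyth X)"
      and eq: "smyth X closure_of {k} = smyth X closure_of {l}"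
    have same: "elts k \<subseteq> U \<longleftrightarrow> elts l \<subseteq> U" if "openin X U" for U
      using smyth_closure_eq_iff[of "{k}" X l] k l eq that by auto
    have sat: "\<exists>\<U>. (\<forall>U\<in>\<U>. openin X U) \<and> elts m = topspace X \<inter> \<Inter>\<U>"
      if "m \<in> topspace (smyth X)" for m
      using that by (simp add: topspace_smyth compact_saturated_def saturated_in_def)
    have sub: "elts m \<subseteq> elts n" if mn: "m \<in> topspace (smyth X)" "n \<in> topspace (smyth X)"
      "\<And>U. openin X U \<Longrightarrow> elts n \<subseteq> U \<Longrightarrow> elts m \<subseteq> U" for m n
    proof -
      obtain \<U> where \<U>: "\<forall>U\<in>\<U>. openin X U" "elts n = topspace X \<inter> \<Inter>\<U>"
        using sat[OF mn(2)] by blast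
      have "elts m \<subseteq> U" if "U \<in> \<U>" for U
        using mn(3)[of U] \<U> that by blast
      moreover have "elts m \<subseteq> topspace X"
        using mn(1) by (simp add: topspace_smyth compact_saturated_subset)
      ultimately show ?thesis
        using \<U>(2) by blast
    qed
    have "elts k = elts l"
      by (intro equalityI sub) (use k l same in auto)
    then show "k = l"
      by (rule elts_inject)
  qed
  ultimately show ?thesis
    by (simp add: Obj_Top0)
qed

lemma elts_smyth_map:
  assumes "Y \<in> Obj Top0" and "continuous_map X Y f" and "k \<in> topspace (smyth X)"
  shows "elts (as_elt (up_closure Y (f ` elts k))) = up_closure Y (f ` elts k)"
    and "up_closure Y (f ` elts k) \<in> compact_saturated Y"
proof -
  have "compactin X (elts k)" "elts k \<noteq> {}"
    using assms(3) by (auto simp: topspace_smyth compact_saturated_def)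
  then have "compactin Y (f ` elts k)" "f ` elts k \<noteq> {}"
    using assms(2) image_compactin by auto
  then show *: "up_closure Y (f ` elts k) \<in> compact_saturated Y"
    by (rule up_closure_compact_saturated)
  show "elts (as_elt (up_closure Y (f ` elts k))) = up_closure Y (f ` elts k)"
    by (intro elts_as_elt small_subset_topspace[OF assms(1)] compact_saturated_subset *)
qed

lemma continuous_map_smyth:
  assumes "Y \<in> Obj Top0" and f: "continuous_map X Y f"
  shows "continuous_map (smyth X) (smyth Y) (\<lambda>k. as_elt (up_closure Y (f ` elts k)))"
    (is "continuous_map _ _ ?F")
proof (rule continuous_map_into_smyth)
  show "elts (?F k) \<in> compact_saturated Y" if "k \<in> topspace (smyth X)" for k
    using elts_smyth_map[OF assms that] by simp
  fix V assume V: "openin Y V"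
  have "elts (?F k) \<subseteq> V \<longleftrightarrow> elts k \<subseteq> {x \<in> topspace X. f x \<in> V}" if k: "k \<in> topspace (smyth X)" for k
  proof -
    have kX: "elts k \<subseteq> topspace X"
      using k by (simp add: topspace_smyth compact_saturated_subset)
    then have "f ` elts k \<subseteq> topspace Y"
      using continuous_map_image_subset_topspace[OF f] by blast
    then have "elts (?F k) \<subseteq> V \<longleftrightarrow> f ` elts k \<subseteq> V"
      by (simp add: elts_smyth_map[OF assms k] up_closure_subset_open_iff V)
    then show ?thesis
      using kX by blast
  qed
  then have "{k \<in> topspace (smyth X). elts (?F k) \<subseteq> V} =
      {k. elts k \<in> compact_saturated X \<and> elts k \<subseteq> {x \<in> topspace X. f x \<in> V}}"
    unfolding topspace_smyth by blast
  then show "openin (smyth X) {k \<in> topspace (smyth X). elts (?F k) \<subseteq> V}"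
    using openin_smyth_box[OF openin_continuous_map_preimage[OF f V]] by simp
qed

lemma R_subset_system_image:
  assumes "R_subset_system H" "X \<in> Obj Top0" "Y \<in> Obj Top0" "continuous_map X Y f" "A \<in> fobj H X"
  shows "f ` A \<in> fobj H Y"
proof -
  have "A \<subseteq> topspace X"
    using assms(1,2,5) by (auto simp: R_subset_system_def irreducible_in_def)
  then have "restrict f (topspace X) ` A = f ` A"
    by (intro image_cong) auto
  then show ?thesis
    using assms restrict_in_Hom[OF assms(4)] unfolding R_subset_system_def by metis
qed

lemma R_subset_system_subset:
  assumes "R_subset_system H" "X \<in> Obj Top0" "A \<in> fobj H X"
  shows "A \<subseteq> topspace X" and "A \<noteq> {}"
  using assms by (auto simp: R_subset_system_def irreducible_in_def)


section \<open>Determined sets and super sobriety\<close>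

text \<open>The sets \<open>\<up>{x}\<close> embed \<open>X\<close> into its Smyth power space. If \<open>K\<close> is generic for the image of
  \<open>A \<in> H(X)\<close>, then \<open>K\<close> meets the closure of \<open>A\<close>, and any point in the intersection is generic
  in that closure.\<close>

lemma super_H_sober_imp_H_sober:
  assumes H: "R_subset_system H" and X: "super_H_sober H X"
  shows "H_sober H X"
  unfolding H_sober_def
proof (intro conjI ballI)
  show X0: "X \<in> Obj Top0"
    using X by (simp add: super_H_sober_def)
  fix A assume A: "A \<in> fobj H X"
  have sub: "A \<subseteq> topspace X"
    using R_subset_system_subset[OF H X0 A] by blast
  define e where "e x = as_elt (up_closure X {x})" for x
  have up: "up_closure X {x} \<in> compact_saturated X" "elts (e x) = up_closure X {x}"
    if "x \<in> topspace X" for x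
  proof -
    show *: "up_closure X {x} \<in> compact_saturated X"
      using that by (intro up_closure_compact_saturated) auto
    show "elts (e x) = up_closure X {x}"
      unfolding e_def
      by (intro elts_as_elt small_subset_topspace[OF X0] compact_saturated_subset *)
  qed
  have e: "elts (e x) \<subseteq> U \<longleftrightarrow> x \<in> U" if "x \<in> topspace X" "openin X U" for x U
    using up[OF that(1)] up_closure_subset_open_iff[OF _ that(2), of "{x}"] that(1) by simp
  have "continuous_map X (smyth X) e"
  proof (rule continuous_map_into_smyth)
    show "elts (e x) \<in> compact_saturated X" if "x \<in> topspace X" for x
      using up[OF that] by simp
    fix U assume U: "openin X U"
    have "{x \<in> topspace X. elts (e x) \<subseteq> U} = U"
      using e[OF _ U] openin_subset[OF U] by blast
    then show "openin X {x \<in> topspace X. elts (e x) \<subseteq> U}"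
      using U by simp
  qed
  then have eA: "e ` A \<in> fobj H (smyth X)"
    using R_subset_system_image[OF H X0 smyth_in_Top0[OF X0] _ A] by blast
  then obtain q where q: "q \<in> topspace (smyth X)"
    "smyth X closure_of (e ` A) = smyth X closure_of {q}"
    using X unfolding super_H_sober_def H_sober_def by blast
  have qU: "elts q \<subseteq> U \<longleftrightarrow> A \<inter> U \<noteq> {}" if "openin X U" for U
  proof -
    have "elts q \<subseteq> U \<longleftrightarrow> (\<exists>k\<in>e ` A. elts k \<subseteq> U)"
      using smyth_closure_eq_iff[OF R_subset_system_subset(1)[OF H smyth_in_Top0[OF X0] eA] q(1)]
        q(2) that by simp
    also have "\<dots> \<longleftrightarrow> (\<exists>x\<in>A. x \<in> U)"
      using e[OF _ that] sub by (simp add: subset_iff)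
    finally show ?thesis
      by blast
  qed
  have "elts q \<subseteq> topspace X"
    using q(1) by (simp add: topspace_smyth compact_saturated_subset)
  moreover have "\<not> elts q \<subseteq> topspace X - X closure_of A"
    using qU[OF openin_compl_closure_of, of A] closure_of_subset[OF sub] by blast
  ultimately obtain x where x: "x \<in> elts q" "x \<in> X closure_of A"
    by blast
  have "x \<in> topspace X"
    using x(2) by (simp add: in_closure_of)
  moreover have "X closure_of A = X closure_of {x}"
    using sub calculation x qU
    by (subst closure_eq_iff_meet_same_opens) (auto simp: in_closure_of)
  ultimately show "\<exists>x\<in>topspace X. X closure_of A = X closure_of {x}"
    by blast
qed

text \<open>The point is unique because the space is \<open>T\<^sub>0\<close>, so only existence has to be checked.\<close>

lemma super_H_sober_determinedI:
  assumes "A \<subseteq> topspace X" "A \<noteq> {}"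
    and "\<And>Y f. super_H_sober H Y \<Longrightarrow> continuous_map X Y f \<Longrightarrow>
      \<exists>y\<in>topspace Y. Y closure_of (f ` A) = Y closure_of {y}"
  shows "super_H_sober_determined H X A"
  unfolding super_H_sober_determined_def
proof (intro conjI allI impI assms(1,2))
  fix Y f assume Y: "super_H_sober H Y" and f: "continuous_map X Y f"
  have "t0_space Y"
    using Y by (simp add: super_H_sober_def Obj_Top0)
  then show "\<exists>!y. y \<in> topspace Y \<and> Y closure_of (f ` A) = Y closure_of {y}"
    using assms(3)[OF Y f] t0_closure_of_singleton_inject[of Y] by metis
qed

text \<open>This is the existence part of the topological Rudin lemma. The intersection of a nonempty chain
  of closed sets that meet a compact set meets it again, so Zorn's lemma applies.\<close>

lemma minimal_closed_meeting_compacts: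
  assumes comp: "\<And>K. K \<in> \<K> \<Longrightarrow> compactin X K"
    and C: "closedin X C" "\<And>K. K \<in> \<K> \<Longrightarrow> K \<inter> C \<noteq> {}"
  shows "\<exists>A. closedin X A \<and> A \<subseteq> C \<and> (\<forall>K\<in>\<K>. K \<inter> A \<noteq> {}) \<and>
    (\<forall>B. closedin X B \<longrightarrow> B \<subseteq> A \<longrightarrow> (\<forall>K\<in>\<K>. K \<inter> B \<noteq> {}) \<longrightarrow> B = A)"
proof -
  \<comment> \<open>Zorn's lemma is applied to the open complements, for which minimality becomes maximality.\<close>
  define \<O> where "\<O> = {U. openin X U \<and> topspace X - C \<subseteq> U \<and> (\<forall>K\<in>\<K>. \<not> K \<subseteq> U)}"
  have C0: "topspace X - C \<in> \<O>"
    using C unfolding \<O>_def by blast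
  have "\<exists>M\<in>\<O>. \<forall>U\<in>\<O>. M \<subseteq> U \<longrightarrow> U = M"
  proof (rule subset_Zorn_nonempty)
    show "\<O> \<noteq> {}"
      using C0 by blast
    fix \<C> assume ne: "\<C> \<noteq> {}" and chain: "subset.chain \<O> \<C>"
    then have sub: "\<C> \<subseteq> \<O>"
      by (simp add: subset.chain_def)
    have "\<not> K \<subseteq> \<Union>\<C>" if K: "K \<in> \<K>" for K
    proof
      assume "K \<subseteq> \<Union>\<C>"
      moreover have "\<forall>U\<in>\<C>. openin X U"
        using sub unfolding \<O>_def by blast
      ultimately obtain \<F> where \<F>: "finite \<F>" "\<F> \<subseteq> \<C>" "K \<subseteq> \<Union>\<F>"
        using comp[OF K] unfolding compactin_def by metis
      have "K \<noteq> {}"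
        using C(2)[OF K] by blast
      then have "\<F> \<noteq> {}"
        using \<F>(3) by blast
      moreover have "subset.chain \<O> \<F>"
        using chain \<F>(2) by (simp add: subset_chain_def) (metis subsetD order_trans)
      ultimately have "\<Union>\<F> \<in> \<F>"
        using \<F>(1) by (intro Union_in_chain)
      then show False
        using \<F> sub K unfolding \<O>_def by blast
    qed
    then show "\<Union>\<C> \<in> \<O>"
      using sub ne unfolding \<O>_def by blast
  qed
  then obtain M where M: "M \<in> \<O>" and max: "\<And>U. U \<in> \<O> \<Longrightarrow> M \<subseteq> U \<Longrightarrow> U = M"
    by blast
  show ?thesis
  proof (intro exI[of _ "topspace X - M"] conjI allI impI ballI)
    show "closedin X (topspace X - M)"
      using M unfolding \<O>_def by blast
    show "topspace X - M \<subseteq> C"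
      using M unfolding \<O>_def by blast
    show "K \<inter> (topspace X - M) \<noteq> {}" if "K \<in> \<K>" for K
      using M that compactin_subset_topspace[OF comp[OF that]] unfolding \<O>_def by blast
    fix B assume B: "closedin X B" "B \<subseteq> topspace X - M" "\<forall>K\<in>\<K>. K \<inter> B \<noteq> {}"
    have "topspace X - B \<in> \<O>" "M \<subseteq> topspace X - B"
      using M B closedin_subset[OF C(1)] openin_subset[of X M] unfolding \<O>_def by auto
    then have "topspace X - B = M"
      by (rule max)
    then show "B = topspace X - M"
      using closedin_subset[OF B(1)] by blast
  qed
qed

text \<open>Let \<open>f\<close> be a continuous map into a super \<open>H\<close>-sober space \<open>Y\<close>. By property M the sets
  \<open>\<up>(K \<inter> A)\<close> form a member of \<open>H(P\<^sub>S X)\<close>, their images form a member of \<open>H(P\<^sub>S Y)\<close>, and these have a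
  generic compact set \<open>Q\<close>, represented by the point \<open>q\<close> of \<open>P\<^sub>S Y\<close>. The set \<open>Q\<close> meets the closure of
  \<open>f(A)\<close> in some point \<open>y\<close>, and the preimage of the closure of \<open>y\<close> still meets every \<open>K \<inter> A\<close>;
  minimality forces it to contain \<open>A\<close>.\<close>

lemma minimal_closed_determined:
  fixes H :: "'u::grothendieck_universe subset_system"
  assumes H: "R_subset_system H" "property_M H"
    and X: "X \<in> Obj Top0" and \<K>: "\<K> \<in> fobj H (smyth X)"
    and A: "closedin X A" "\<And>k. k \<in> \<K> \<Longrightarrow> elts k \<inter> A \<noteq> {}"
    and min: "\<And>B. closedin X B \<Longrightarrow> B \<subseteq> A \<Longrightarrow> (\<And>k. k \<in> \<K> \<Longrightarrow> elts k \<inter> B \<noteq> {}) \<Longrightarrow> B = A"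
  shows "super_H_sober_determined H X A"
proof (rule super_H_sober_determinedI)
  show AX: "A \<subseteq> topspace X"
    using A(1) by (rule closedin_subset)
  have \<K>_sub: "\<K> \<subseteq> topspace (smyth X)" and \<K>_ne: "\<K> \<noteq> {}"
    using R_subset_system_subset[OF H(1) smyth_in_Top0[OF X] \<K>] by auto
  show "A \<noteq> {}"
    using \<K>_ne A(2) by blast
  fix Y :: "'u topology" and f
  assume Y: "super_H_sober H Y" and f: "continuous_map X Y f"
  have Y0: "Y \<in> Obj Top0" and sober: "H_sober H (smyth Y)"
    using Y by (auto simp: super_H_sober_def)
  define \<rho> where "\<rho> k = as_elt (up_closure X (elts k \<inter> A))" for k
  define \<sigma> where "\<sigma> k = as_elt (up_closure Y (f ` elts k))" for k
  have "\<rho> ` \<K> \<in> fobj H (smyth X)"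
    using H(2) X \<K> A unfolding property_M_def \<rho>_def by blast
  then have \<sigma>\<rho>: "\<sigma> ` \<rho> ` \<K> \<in> fobj H (smyth Y)"
    unfolding \<sigma>_def
    by (rule R_subset_system_image[OF H(1) smyth_in_Top0[OF X] smyth_in_Top0[OF Y0]
          continuous_map_smyth[OF Y0 f]])
  then obtain q where q: "q \<in> topspace (smyth Y)"
    "smyth Y closure_of (\<sigma> ` \<rho> ` \<K>) = smyth Y closure_of {q}"
    using sober unfolding H_sober_def by blast
  have \<rho>: "elts (\<rho> k) = up_closure X (elts k \<inter> A)" "\<rho> k \<in> topspace (smyth X)" if "k \<in> \<K>" for k
  proof -
    have "compactin X (elts k)"
      using that \<K>_sub by (auto simp: topspace_smyth compact_saturated_def)
    then have cs: "up_closure X (elts k \<inter> A) \<in> compact_saturated X"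
      using A that by (intro up_closure_compact_saturated compact_Int_closedin) auto
    show "elts (\<rho> k) = up_closure X (elts k \<inter> A)"
      unfolding \<rho>_def by (intro elts_as_elt small_subset_topspace[OF X] compact_saturated_subset cs)
    with cs show "\<rho> k \<in> topspace (smyth X)"
      by (simp add: topspace_smyth)
  qed
  have meet: "elts (\<sigma> (\<rho> k)) \<subseteq> V \<longleftrightarrow> f ` (elts k \<inter> A) \<subseteq> V" if k: "k \<in> \<K>" and V: "openin Y V" for k V
  proof -
    have \<rho>X: "elts (\<rho> k) \<subseteq> topspace X"
      using \<rho>(2)[OF k] by (simp add: topspace_smyth compact_saturated_subset)
    have kA: "elts k \<inter> A \<subseteq> topspace X"
      using AX by blast
    have "elts (\<sigma> (\<rho> k)) \<subseteq> V \<longleftrightarrow> f ` elts (\<rho> k) \<subseteq> V"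
      using elts_smyth_map(1)[OF Y0 f \<rho>(2)[OF k]] up_closure_subset_open_iff[OF _ V]
        continuous_map_image_subset_topspace[OF f] \<rho>X unfolding \<sigma>_def by (metis image_mono subset_trans)
    also have "\<dots> \<longleftrightarrow> elts (\<rho> k) \<subseteq> {x \<in> topspace X. f x \<in> V}"
      using \<rho>X by blast
    also have "\<dots> \<longleftrightarrow> elts k \<inter> A \<subseteq> {x \<in> topspace X. f x \<in> V}"
      unfolding \<rho>(1)[OF k]
      by (rule up_closure_subset_open_iff[OF kA openin_continuous_map_preimage[OF f V]])
    also have "\<dots> \<longleftrightarrow> f ` (elts k \<inter> A) \<subseteq> V"
      using kA by blast
    finally show ?thesis .
  qed
  have qV: "elts q \<subseteq> V \<longleftrightarrow> (\<exists>k\<in>\<K>. f ` (elts k \<inter> A) \<subseteq> V)" if V: "openin Y V" for V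
  proof -
    have "\<sigma> ` \<rho> ` \<K> \<subseteq> topspace (smyth Y)"
      using R_subset_system_subset[OF H(1) smyth_in_Top0[OF Y0] \<sigma>\<rho>] by blast
    then show ?thesis
      using smyth_closure_eq_iff[OF _ q(1)] q(2) V meet by (auto simp: image_iff)
  qed
  have fA: "f ` A \<subseteq> topspace Y"
    using AX continuous_map_image_subset_topspace[OF f] by blast
  have qY: "elts q \<subseteq> topspace Y"
    using q(1) by (simp add: topspace_smyth compact_saturated_subset)
  have "\<not> elts q \<subseteq> topspace Y - Y closure_of (f ` A)"
  proof
    assume "elts q \<subseteq> topspace Y - Y closure_of (f ` A)"
    then obtain k where k: "k \<in> \<K>" "f ` (elts k \<inter> A) \<subseteq> topspace Y - Y closure_of (f ` A)"
      using qV[OF openin_compl_closure_of] by blast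
    moreover obtain a where "a \<in> elts k \<inter> A"
      using A(2)[OF k(1)] by blast
    ultimately show False
      using closure_of_subset[OF fA] by blast
  qed
  then obtain y where y: "y \<in> elts q" "y \<in> Y closure_of (f ` A)"
    using qY by blast
  have yY: "y \<in> topspace Y"
    using y(1) qY by blast
  define B where "B = A \<inter> {x \<in> topspace X. f x \<in> Y closure_of {y}}"
  have "B = A"
  proof (rule min)
    show "closedin X B"
      unfolding B_def by (intro closedin_Int A(1) closedin_continuous_map_preimage[OF f]) simp
    show "B \<subseteq> A"
      by (simp add: B_def)
    fix k assume k: "k \<in> \<K>"
    have "y \<in> Y closure_of {y}"
      using yY closure_of_subset[of "{y}" Y] by auto
    then have "\<not> elts q \<subseteq> topspace Y - Y closure_of {y}"
      using y(1) by blast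
    then have "\<not> f ` (elts k \<inter> A) \<subseteq> topspace Y - Y closure_of {y}"
      using qV[OF openin_compl_closure_of, of "{y}"] k by blast
    then show "elts k \<inter> B \<noteq> {}"
      using fA AX unfolding B_def by blast
  qed
  then have "f ` A \<subseteq> Y closure_of {y}"
    unfolding B_def by blast
  then have "Y closure_of (f ` A) = Y closure_of {y}"
    using y(2) by (intro antisym closure_of_minimal) auto
  with yY show "\<exists>y\<in>topspace Y. Y closure_of (f ` A) = Y closure_of {y}"
    by blast
qed

text \<open>The generic compact set of \<open>\<K>\<close> is the intersection of all open sets that include a member
  of \<open>\<K>\<close>. If an open \<open>W\<close> includes this intersection but no member of \<open>\<K>\<close>, then the complement of
  \<open>W\<close> meets all members and so includes a minimal such closed set, which is determined. Its generic
  point lies in the intersection and outside \<open>W\<close>.\<close>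

lemma super_H_soberI:
  fixes H :: "'u::grothendieck_universe subset_system"
  assumes H: "R_subset_system H" "property_M H" and X: "X \<in> Obj Top0"
    and generic: "\<And>A. A \<in> HDc H X \<Longrightarrow> \<exists>x\<in>topspace X. A = X closure_of {x}"
  shows "super_H_sober H X"
  unfolding super_H_sober_def H_sober_def
proof (intro conjI ballI X smyth_in_Top0)
  fix \<K> assume \<K>: "\<K> \<in> fobj H (smyth X)"
  have \<K>_sub: "\<K> \<subseteq> topspace (smyth X)" and \<K>_ne: "\<K> \<noteq> {}"
    using R_subset_system_subset[OF H(1) smyth_in_Top0[OF X] \<K>] by auto
  have cs: "elts k \<in> compact_saturated X" if "k \<in> \<K>" for k
    using that \<K>_sub by (auto simp: topspace_smyth)
  define \<U> where "\<U> = {U. openin X U \<and> (\<exists>k\<in>\<K>. elts k \<subseteq> U)}"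
  define Q where "Q = topspace X \<inter> \<Inter>\<U>"
  have QX: "Q \<subseteq> topspace X"
    by (simp add: Q_def)
  have open_nhd: "W \<in> \<U>" if W: "openin X W" "Q \<subseteq> W" for W
  proof (rule ccontr)
    assume "W \<notin> \<U>"
    then have no: "\<not> elts k \<subseteq> W" if "k \<in> \<K>" for k
      using that W(1) by (auto simp: \<U>_def)
    have "\<exists>A. closedin X A \<and> A \<subseteq> topspace X - W \<and> (\<forall>K\<in>elts ` \<K>. K \<inter> A \<noteq> {}) \<and>
        (\<forall>B. closedin X B \<longrightarrow> B \<subseteq> A \<longrightarrow> (\<forall>K\<in>elts ` \<K>. K \<inter> B \<noteq> {}) \<longrightarrow> B = A)"
    proof (rule minimal_closed_meeting_compacts)
      show "compactin X K" if "K \<in> elts ` \<K>" for K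
        using that cs by (auto simp: compact_saturated_def)
      show "closedin X (topspace X - W)"
        using W(1) by blast
      show "K \<inter> (topspace X - W) \<noteq> {}" if "K \<in> elts ` \<K>" for K
        using that no compact_saturated_subset[OF cs] by blast
    qed
    then obtain A where A: "closedin X A" "A \<subseteq> topspace X - W" "\<forall>k\<in>\<K>. elts k \<inter> A \<noteq> {}"
      and min: "\<forall>B. closedin X B \<longrightarrow> B \<subseteq> A \<longrightarrow> (\<forall>k\<in>\<K>. elts k \<inter> B \<noteq> {}) \<longrightarrow> B = A"
      by auto
    have "super_H_sober_determined H X A"
      by (rule minimal_closed_determined[OF H X \<K> A(1)]) (use A(3) min in auto)
    then have "A \<in> HDc H X"
      using A(1) by (simp add: HDc_def)
    then obtain x where x: "x \<in> topspace X" "A = X closure_of {x}"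
      using generic by blast
    have "x \<in> U" if U\<U>: "U \<in> \<U>" for U
    proof -
      obtain k where k: "k \<in> \<K>" "elts k \<subseteq> U" and U: "openin X U"
        using U\<U> unfolding \<U>_def by blast
      then have "\<exists>a\<in>U. a \<in> X closure_of {x}"
        using A(3) k x(2) by blast
      then show ?thesis
        using U unfolding in_closure_of by blast
    qed
    then have "x \<in> W"
      using W(2) x(1) by (auto simp: Q_def)
    moreover have "x \<in> A"
      using x closure_of_subset[of "{x}" X] by auto
    ultimately show False
      using A(2) by blast
  qed
  have "Q \<noteq> {}"
  proof
    assume "Q = {}"
    then have "{} \<in> \<U>"
      using open_nhd[of "{}"] by simp
    then show False
      using cs by (auto simp: \<U>_def compact_saturated_def)
  qed
  moreover have "compactin X Q"
    unfolding compactin_def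
  proof (intro conjI allI impI QX)
    fix \<V> assume \<V>: "Ball \<V> (openin X) \<and> Q \<subseteq> \<Union>\<V>"
    \<comment> \<open>Some member of \<open>\<K>\<close> is covered as well; the union of a finite subcover of it belongs to
      \<open>\<U>\<close>, hence includes \<open>Q\<close>.\<close>
    then obtain k where k: "k \<in> \<K>" "elts k \<subseteq> \<Union>\<V>"
      using open_nhd[of "\<Union>\<V>"] by (auto simp: \<U>_def)
    then obtain \<F> where \<F>: "finite \<F>" "\<F> \<subseteq> \<V>" "elts k \<subseteq> \<Union>\<F>"
      using cs[OF k(1)] \<V> unfolding compact_saturated_def compactin_def by blast
    then have "\<Union>\<F> \<in> \<U>"
      using \<V> k(1) by (auto simp: \<U>_def)
    then show "\<exists>\<F>. finite \<F> \<and> \<F> \<subseteq> \<V> \<and> Q \<subseteq> \<Union>\<F>"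
      using \<F> unfolding Q_def by blast
  qed
  moreover have "saturated_in X Q"
    unfolding saturated_in_def by (rule exI[of _ \<U>]) (auto simp: Q_def \<U>_def)
  ultimately have Q: "Q \<in> compact_saturated X"
    by (simp add: compact_saturated_def)
  have eQ: "elts (as_elt Q) = Q"
    by (intro elts_as_elt small_subset_topspace[OF X] QX)
  have q: "as_elt Q \<in> topspace (smyth X)"
    using Q eQ by (simp add: topspace_smyth)
  moreover have "smyth X closure_of \<K> = smyth X closure_of {as_elt Q}"
    unfolding smyth_closure_eq_iff[OF \<K>_sub q] eQ
    using open_nhd by (auto simp: \<U>_def Q_def)
  ultimately show "\<exists>x\<in>topspace (smyth X). smyth X closure_of \<K> = smyth X closure_of {x}"
    by blast
qed


section \<open>Determined sets are irreducible\<close>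

text \<open>Irreducibility singles out one of the finitely many closures \<open>cl {x}\<close>, \<open>x \<in> A\<close>, that cover \<open>A\<close>.\<close>

lemma irreducible_in_finite_space:
  assumes "finite (topspace X)" and A: "irreducible_in X A"
  shows "\<exists>x\<in>topspace X. X closure_of A = X closure_of {x}"
proof -
  have AX: "A \<subseteq> topspace X"
    using A by (simp add: irreducible_in_def)
  have "\<exists>x\<in>F. A \<subseteq> X closure_of {x}" if "finite F" "A \<subseteq> (\<Union>x\<in>F. X closure_of {x})" for F
    using that
  proof (induction F)
    case empty
    then show ?case
      using A by (simp add: irreducible_in_def)
  next
    case (insert x F)
    have "closedin X (\<Union>x\<in>F. X closure_of {x})"
      using insert.hyps(1) by (intro closedin_Union) auto
    moreover have "A \<subseteq> X closure_of {x} \<union> (\<Union>x\<in>F. X closure_of {x})"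
      using insert.prems by simp
    ultimately have "A \<subseteq> X closure_of {x} \<or> A \<subseteq> (\<Union>x\<in>F. X closure_of {x})"
      using A closedin_closure_of[of X "{x}"] unfolding irreducible_in_def by simp
    then show ?case
      using insert.IH by blast
  qed
  moreover have "x \<in> X closure_of {x}" if "x \<in> A" for x
    using AX closure_of_subset[of "{x}" X] that by auto
  then have "A \<subseteq> (\<Union>x\<in>A. X closure_of {x})"
    by blast
  ultimately obtain x where x: "x \<in> A" "A \<subseteq> X closure_of {x}"
    using finite_subset[OF AX assms(1)] by blast
  then have "X closure_of A = X closure_of {x}"
    by (intro antisym closure_of_minimal[OF x(2)] closure_of_mono) auto
  then show ?thesis
    using x(1) AX by blast
qed

text \<open>The Smyth power space of a finite space is finite. Finite \<open>T\<^sub>0\<close> spaces thus serve as codomains that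
  test for determinedness.\<close>

lemma finite_t0_super_H_sober:
  assumes H: "R_subset_system H" and X: "X \<in> Obj Top0" "finite (topspace X)"
  shows "super_H_sober H X"
  unfolding super_H_sober_def H_sober_def
proof (intro conjI ballI X(1) smyth_in_Top0)
  fix \<K> assume "\<K> \<in> fobj H (smyth X)"
  then have "irreducible_in (smyth X) \<K>"
    using H smyth_in_Top0[OF X(1)] by (simp add: R_subset_system_def)
  moreover have "finite (topspace (smyth X))"
  proof (rule finite_imageD)
    show "finite (elts ` topspace (smyth X))"
    proof (rule finite_subset)
      show "elts ` topspace (smyth X) \<subseteq> Pow (topspace X)"
        using compact_saturated_subset by (auto simp: topspace_smyth)
    qed (use X(2) in simp)
    show "inj_on elts (topspace (smyth X))"
      by (simp add: inj_on_def elts_eq_iff)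
  qed
  ultimately show "\<exists>k\<in>topspace (smyth X). smyth X closure_of \<K> = smyth X closure_of {k}"
    by (intro irreducible_in_finite_space)
qed

text \<open>The map \<open>f\<close> from \<open>X\<close> into the square of the Sierpinski space given by the open sets \<open>U\<close> and
  \<open>V\<close> tests whether \<open>A\<close> meets \<open>U \<inter> V\<close>: a point generic for the image of \<open>A\<close> has both coordinates
  equal to the open point as soon as \<open>A\<close> meets \<open>U\<close> and \<open>V\<close>. The square is realised as the power set
  of \<open>{p, q}\<close>, where \<open>p \<in> f(x)\<close> encodes \<open>x \<in> U\<close> and \<open>q \<in> f(x)\<close> encodes \<open>x \<in> V\<close>.\<close>

lemma determined_meets_Int:
  fixes H :: "'u::grothendieck_universe subset_system"
  assumes H: "R_subset_system H" and A: "super_H_sober_determined H X A"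
    and U: "openin X U" "A \<inter> U \<noteq> {}" and V: "openin X V" "A \<inter> V \<noteq> {}"
  shows "A \<inter> (U \<inter> V) \<noteq> {}"
proof -
  obtain p q :: 'u where pq: "p \<noteq> q" "small {p, q}"
    using small_two_points by blast
  define S where "S = {k. elts k \<subseteq> {p, q}}"
  define Y where "Y = topology_generated_by {S, {k\<in>S. p \<in> elts k}, {k\<in>S. q \<in> elts k}}"
  have topY: "topspace Y = S"
    unfolding Y_def topology_generated_by_topspace by auto
  have openp: "openin Y {k\<in>S. p \<in> elts k}" and openq: "openin Y {k\<in>S. q \<in> elts k}"
    unfolding Y_def by (auto intro: topology_generated_by_Basis)
  have "t0_space Y"
    unfolding t0_space_def topY
  proof (intro ballI impI)
    fix k l assume kl: "k \<in> S" "l \<in> S" "k \<noteq> l"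
    then have "elts k \<noteq> elts l"
      by (simp add: elts_eq_iff)
    then have "(p \<in> elts k) \<noteq> (p \<in> elts l) \<or> (q \<in> elts k) \<noteq> (q \<in> elts l)"
      using kl unfolding S_def by blast
    then have "(k \<notin> {k\<in>S. p \<in> elts k}) = (l \<in> {k\<in>S. p \<in> elts k}) \<or>
        (k \<notin> {k\<in>S. q \<in> elts k}) = (l \<in> {k\<in>S. q \<in> elts k})"
      using kl by blast
    then show "\<exists>W. openin Y W \<and> (k \<notin> W) = (l \<in> W)"
      using openp openq by blast
  qed
  moreover have "small S"
    unfolding S_def by (rule small_Pow[OF pq(2)])
  moreover have "finite S"
  proof (rule finite_imageD)
    show "finite (elts ` S)"
      by (rule finite_subset[of _ "Pow {p, q}"]) (auto simp: S_def)
    show "inj_on elts S"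
      by (simp add: inj_on_def elts_eq_iff)
  qed
  ultimately have Y: "super_H_sober H Y"
    by (intro finite_t0_super_H_sober[OF H]) (simp_all add: Obj_Top0 topY)
  define f where "f x = as_elt ((if x \<in> U then {p} else {}) \<union> (if x \<in> V then {q} else {}))" for x
  have "elts (f x) = (if x \<in> U then {p} else {}) \<union> (if x \<in> V then {q} else {})" for x
    unfolding f_def by (intro elts_as_elt small_subset[OF pq(2)]) auto
  then have f: "f x \<in> S" "p \<in> elts (f x) \<longleftrightarrow> x \<in> U" "q \<in> elts (f x) \<longleftrightarrow> x \<in> V" for x
    using pq(1) by (auto simp: S_def)
  have cont: "continuous_map X Y f"
    unfolding Y_def
  proof (rule continuous_on_generated_topo)
    fix W assume "W \<in> {S, {k \<in> S. p \<in> elts k}, {k \<in> S. q \<in> elts k}}"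
    moreover have "f -` {k \<in> S. p \<in> elts k} \<inter> topspace X = U"
      "f -` {k \<in> S. q \<in> elts k} \<inter> topspace X = V" "f -` S \<inter> topspace X = topspace X"
      using f openin_subset[OF U(1)] openin_subset[OF V(1)] by auto
    ultimately show "openin X (f -` W \<inter> topspace X)"
      using U(1) V(1) by auto
  qed (use f in auto)
  obtain y where y: "y \<in> topspace Y" "Y closure_of (f ` A) = Y closure_of {y}"
    using A Y cont unfolding super_H_sober_determined_def by metis
  have "f ` A \<subseteq> topspace Y"
    using f topY by auto
  then have same: "f ` A \<inter> W \<noteq> {} \<longleftrightarrow> y \<in> W" if "openin Y W" for W
    using closure_eq_iff_meet_same_opens[of "f ` A" Y "{y}"] y that by auto
  have "y \<in> {k \<in> S. p \<in> elts k}" "y \<in> {k \<in> S. q \<in> elts k}"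
    using U(2) V(2) f same[OF openp] same[OF openq] by auto
  then have "f ` A \<inter> ({k \<in> S. p \<in> elts k} \<inter> {k \<in> S. q \<in> elts k}) \<noteq> {}"
    using same[OF openin_Int[OF openp openq]] by blast
  then show ?thesis
    using f by auto
qed


section \<open>The reflection of a space\<close>

lemma HDc_subset: "A \<in> HDc H X \<Longrightarrow> A \<subseteq> topspace X"
  by (simp add: HDc_def closedin_subset)

lemma elts_as_elt_HDc:
  assumes "X \<in> Obj Top0" and "A \<in> HDc H X"
  shows "elts (as_elt A) = A"
  by (intro elts_as_elt small_subset_topspace[OF assms(1)] HDc_subset[OF assms(2)])

definition diamond :: "'u::grothendieck_universe subset_system \<Rightarrow> 'u topology \<Rightarrow> 'u set \<Rightarrow> 'u set"
  where "diamond H X U = {g. elts g \<in> HDc H X \<and> elts g \<inter> U \<noteq> {}}"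

lemma topspace_XH: "topspace (XH H X) = {g. elts g \<in> HDc H X}"
  unfolding XH_def P_H_def topology_generated_by_topspace by auto

text \<open>The subbase is already the whole topology: \<open>\<diamond>\<close> commutes with unions, and it commutes with
  binary intersections since determined sets are irreducible.\<close>

lemma openin_XH_iff:
  assumes H: "R_subset_system H"
  shows "openin (XH H X) W \<longleftrightarrow> (\<exists>U. openin X U \<and> W = diamond H X U)"
proof
  assume "\<exists>U. openin X U \<and> W = diamond H X U"
  then show "openin (XH H X) W"
    unfolding XH_def P_H_def diamond_def by (auto intro!: topology_generated_by_Basis)
next
  assume "openin (XH H X) W"
  then have "generate_topology_on (insert {g. elts g \<in> HDc H X}
      {{g. elts g \<in> HDc H X \<and> elts g \<inter> U \<noteq> {}} | U. openin X U}) W"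
    unfolding XH_def P_H_def openin_topology_generated_by_iff .
  then show "\<exists>U. openin X U \<and> W = diamond H X U"
  proof induction
    case Empty
    show ?case
      by (rule exI[of _ "{}"]) (simp add: diamond_def)
  next
    case (Int a b)
    then obtain U V where UV: "openin X U" "a = diamond H X U" "openin X V" "b = diamond H X V"
      by blast
    have "diamond H X U \<inter> diamond H X V = diamond H X (U \<inter> V)"
    proof (intro equalityI subsetI)
      fix g assume "g \<in> diamond H X U \<inter> diamond H X V"
      then show "g \<in> diamond H X (U \<inter> V)"
        using determined_meets_Int[OF H _ UV(1) _ UV(3), of "elts g"]
        by (simp add: diamond_def HDc_def)
    qed (auto simp: diamond_def)
    then show ?case
      using UV by blast
  next
    case (UN \<W>)
    define \<V> where "\<V> = {U. openin X U \<and> diamond H X U \<in> \<W>}"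
    have "\<Union>\<W> = diamond H X (\<Union>\<V>)"
    proof (intro equalityI subsetI)
      fix g assume "g \<in> \<Union>\<W>"
      then obtain w where "w \<in> \<W>" "g \<in> w"
        by blast
      then obtain U where "U \<in> \<V>" "g \<in> diamond H X U"
        using UN.IH by (auto simp: \<V>_def)
      then show "g \<in> diamond H X (\<Union>\<V>)"
        by (auto simp: diamond_def)
    next
      fix g assume "g \<in> diamond H X (\<Union>\<V>)"
      then obtain U where "U \<in> \<V>" "g \<in> diamond H X U"
        by (auto simp: diamond_def)
      then show "g \<in> \<Union>\<W>"
        by (auto simp: \<V>_def)
    qed
    moreover have "openin X (\<Union>\<V>)"
      by (auto simp: \<V>_def)
    ultimately show ?case
      by blast
  next
    case (Basis s)
    then consider "s = {g. elts g \<in> HDc H X}"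
      | U where "openin X U" "s = diamond H X U"
      by (auto simp: diamond_def)
    then show ?case
    proof cases
      case 1
      have "s = diamond H X (topspace X)"
        unfolding 1 diamond_def
        by (auto simp: HDc_def super_H_sober_determined_def)
      then show ?thesis
        by blast
    qed blast
  qed
qed

lemma continuous_map_XH_iff:
  assumes "R_subset_system H"
  shows "continuous_map X (XH H Y) f \<longleftrightarrow>
    (\<forall>x\<in>topspace X. elts (f x) \<in> HDc H Y) \<and>
    (\<forall>V. openin Y V \<longrightarrow> openin X {x \<in> topspace X. elts (f x) \<inter> V \<noteq> {}})" (is "?L \<longleftrightarrow> ?P \<and> ?R")
proof -
  have "?L \<longleftrightarrow> ?P \<and> (\<forall>V. openin Y V \<longrightarrow> openin X {x \<in> topspace X. f x \<in> diamond H Y V})"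
    unfolding continuous_map openin_XH_iff[OF assms] topspace_XH by auto
  also have "\<dots> \<longleftrightarrow> ?P \<and> ?R"
  proof (rule conj_cong[OF refl])
    assume ?P
    then have "{x \<in> topspace X. f x \<in> diamond H Y V} = {x \<in> topspace X. elts (f x) \<inter> V \<noteq> {}}" for V
      by (auto simp: diamond_def)
    then show "(\<forall>V. openin Y V \<longrightarrow> openin X {x \<in> topspace X. f x \<in> diamond H Y V}) \<longleftrightarrow> ?R"
      by simp
  qed
  finally show ?thesis .
qed

lemma XH_in_Top0:
  assumes H: "R_subset_system H" and X: "X \<in> Obj Top0"
  shows "XH H X \<in> Obj Top0"
proof -
  have "small (topspace (XH H X))"
  proof (rule small_subset)
    show "small {k. elts k \<subseteq> topspace X}"
      using X by (simp add: small_Pow Obj_Top0)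
    show "topspace (XH H X) \<subseteq> {k. elts k \<subseteq> topspace X}"
      by (auto simp: topspace_XH dest: HDc_subset)
  qed
  moreover have "t0_space (XH H X)"
    unfolding t0_space_def
  proof (intro ballI impI)
    fix g h assume gh: "g \<in> topspace (XH H X)" "h \<in> topspace (XH H X)" "g \<noteq> h"
    then have ne: "elts g \<noteq> elts h"
      by (simp add: elts_eq_iff)
    have closed: "closedin X (elts g)" "closedin X (elts h)"
      using gh by (auto simp: topspace_XH HDc_def)
    have o: "openin (XH H X) (diamond H X (topspace X - elts m))" if "closedin X (elts m)" for m
      using openin_XH_iff[OF H] openin_diff[OF openin_topspace that] by blast
    have mem: "m \<in> diamond H X (topspace X - elts n) \<longleftrightarrow> \<not> elts m \<subseteq> elts n"
      if "m \<in> topspace (XH H X)" for m n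
      using that HDc_subset[of "elts m" H X] by (auto simp: topspace_XH diamond_def)
    have "\<not> elts g \<subseteq> elts h \<or> \<not> elts h \<subseteq> elts g"
      using ne by blast
    then show "\<exists>W. openin (XH H X) W \<and> (g \<notin> W) = (h \<in> W)"
      using o[OF closed(1)] o[OF closed(2)] mem gh by blast
  qed
  ultimately show ?thesis
    by (simp add: Obj_Top0)
qed

lemma closure_of_image_in_HDc:
  assumes f: "continuous_map X Y f" and A: "super_H_sober_determined H X A"
  shows "Y closure_of (f ` A) \<in> HDc H Y"
proof -
  have AX: "A \<subseteq> topspace X" "A \<noteq> {}"
    using A by (auto simp: super_H_sober_determined_def)
  then have fA: "f ` A \<subseteq> topspace Y"
    using continuous_map_image_subset_topspace[OF f] by blast
  have "super_H_sober_determined H Y (Y closure_of (f ` A))"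
  proof (rule super_H_sober_determinedI)
    show "Y closure_of (f ` A) \<subseteq> topspace Y"
      by (rule closure_of_subset_topspace)
    show "Y closure_of (f ` A) \<noteq> {}"
      using closure_of_subset[OF fA] AX(2) by blast
    fix Z g assume Z: "super_H_sober H Z" and g: "continuous_map Y Z g"
    then have "\<exists>z\<in>topspace Z. Z closure_of ((g \<circ> f) ` A) = Z closure_of {z}"
      using A continuous_map_compose[OF f g] unfolding super_H_sober_determined_def by blast
    then show "\<exists>z\<in>topspace Z. Z closure_of (g ` (Y closure_of (f ` A))) = Z closure_of {z}"
      using closure_of_image_closure_of[OF g fA] by (simp add: image_comp)
  qed
  then show ?thesis
    by (simp add: HDc_def)
qed

lemma closure_of_singleton_in_HDc:
  assumes "x \<in> topspace X"
  shows "X closure_of {x} \<in> HDc H X"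
proof -
  have "super_H_sober_determined H X {x}"
  proof (rule super_H_sober_determinedI)
    fix Y f assume "continuous_map X Y f"
    then have "f x \<in> topspace Y"
      using assms continuous_map_image_subset_topspace by blast
    then show "\<exists>y\<in>topspace Y. Y closure_of (f ` {x}) = Y closure_of {y}"
      by auto
  qed (use assms in auto)
  from closure_of_image_in_HDc[OF continuous_map_id this] show ?thesis
    by simp
qed

lemma elts_eta:
  assumes "X \<in> Obj Top0" and "x \<in> topspace X"
  shows "elts (eta X x) = X closure_of {x}"
  using elts_as_elt_HDc[OF assms(1) closure_of_singleton_in_HDc[OF assms(2)]] assms(2)
  by (simp add: eta_def)

lemma eta_in_diamond_iff:
  assumes "X \<in> Obj Top0" and "x \<in> topspace X" and "openin X U"
  shows "eta X x \<in> diamond H X U \<longleftrightarrow> x \<in> U"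
proof -
  have "U \<inter> X closure_of {x} = {} \<longleftrightarrow> U \<inter> {x} = {}"
    by (rule openin_Int_closure_of_eq_empty[OF assms(3)])
  then show ?thesis
    using elts_eta[OF assms(1,2)] closure_of_singleton_in_HDc[OF assms(2)]
    by (auto simp: diamond_def)
qed

lemma eta_in_Hom:
  assumes H: "R_subset_system H" and X: "X \<in> Obj Top0"
  shows "eta X \<in> Hom Top0 X (XH H X)"
  unfolding Hom_Top0
proof
  have "elts (eta X x) \<inter> U \<noteq> {} \<longleftrightarrow> x \<in> U" if "x \<in> topspace X" "openin X U" for x U
    using eta_in_diamond_iff[OF X that, of H] elts_eta[OF X that(1)]
      closure_of_singleton_in_HDc[OF that(1), of H]
    by (simp add: diamond_def)
  then have "{x \<in> topspace X. elts (eta X x) \<inter> U \<noteq> {}} = U" if "openin X U" for U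
    using that openin_subset by blast
  then show "continuous_map X (XH H X) (eta X)"
    unfolding continuous_map_XH_iff[OF H]
    using elts_eta[OF X] closure_of_singleton_in_HDc[of _ X H] by auto
  show "eta X \<in> extensional (topspace X)"
    by (simp add: eta_def)
qed

text \<open>An open set \<open>\<diamond>U\<close> of the reflection can be recovered from the points \<open>\<eta>(x)\<close> that it contains, so
  \<open>g\<close> and \<open>h\<close> have the same preimages of open sets; the codomain being \<open>T\<^sub>0\<close>, they are equal.\<close>

lemma XH_hom_eqI:
  assumes H: "R_subset_system H" and X: "X \<in> Obj Top0" and Y: "Y \<in> Obj Top0"
    and g: "g \<in> Hom Top0 (XH H X) Y" and h: "h \<in> Hom Top0 (XH H X) Y"
    and eq: "\<And>x. x \<in> topspace X \<Longrightarrow> g (eta X x) = h (eta X x)"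
  shows "g = h"
proof (rule extensionalityI)
  show "g \<in> extensional (topspace (XH H X))" "h \<in> extensional (topspace (XH H X))"
    using g h by (auto simp: Hom_Top0)
  fix a assume a: "a \<in> topspace (XH H X)"
  have ga: "g a \<in> topspace Y" "h a \<in> topspace Y"
    using g h a continuous_map_image_subset_topspace by (auto simp: Hom_Top0 continuous_map_def)
  have eta: "eta X x \<in> topspace (XH H X)" if "x \<in> topspace X" for x
    using that elts_eta[OF X that] closure_of_singleton_in_HDc[OF that, of H]
    by (simp add: topspace_XH)
  have "g a \<in> V \<longleftrightarrow> h a \<in> V" if V: "openin Y V" for V
  proof -
    have "openin (XH H X) {a \<in> topspace (XH H X). g a \<in> V}"
      using g V openin_continuous_map_preimage by (auto simp: Hom_Top0)
    then obtain U where U: "openin X U" "{a \<in> topspace (XH H X). g a \<in> V} = diamond H X U"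
      using openin_XH_iff[OF H] by metis
    have "openin (XH H X) {a \<in> topspace (XH H X). h a \<in> V}"
      using h V openin_continuous_map_preimage by (auto simp: Hom_Top0)
    then obtain U' where U': "openin X U'" "{a \<in> topspace (XH H X). h a \<in> V} = diamond H X U'"
      using openin_XH_iff[OF H] by metis
    have "x \<in> U \<longleftrightarrow> x \<in> U'" if x: "x \<in> topspace X" for x
    proof -
      have "x \<in> U \<longleftrightarrow> g (eta X x) \<in> V"
        using eta_in_diamond_iff[OF X x U(1), of H] U(2) eta[OF x] by blast
      moreover have "x \<in> U' \<longleftrightarrow> h (eta X x) \<in> V"
        using eta_in_diamond_iff[OF X x U'(1), of H] U'(2) eta[OF x] by blast
      ultimately show ?thesis
        using eq[OF x] by simp
    qed
    then have "U = U'"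
      using openin_subset[OF U(1)] openin_subset[OF U'(1)] by blast
    then show ?thesis
      using a U(2) U'(2) by blast
  qed
  then show "g a = h a"
    using Y ga unfolding Obj_Top0 t0_space_def by blast
qed

text \<open>A map into a super \<open>H\<close>-sober space extends by sending a determined set to the generic point
  of its image.\<close>

lemma XH_lift_exists:
  assumes H: "R_subset_system H" and X: "X \<in> Obj Top0" and Y: "super_H_sober H Y"
    and f: "continuous_map X Y f"
  shows "\<exists>g \<in> Hom Top0 (XH H X) Y. (\<forall>x\<in>topspace X. g (eta X x) = f x) \<and>
    (\<forall>a\<in>topspace (XH H X). g a \<in> topspace Y \<and> Y closure_of (f ` elts a) = Y closure_of {g a})"
proof -
  have Y0: "Y \<in> Obj Top0"
    using Y by (simp add: super_H_sober_def)
  have ex: "\<exists>y. y \<in> topspace Y \<and> Y closure_of (f ` elts a) = Y closure_of {y}"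
    if "a \<in> topspace (XH H X)" for a
    using that Y f unfolding topspace_XH HDc_def super_H_sober_determined_def by blast
  define g where
    "g = (\<lambda>a\<in>topspace (XH H X). SOME y. y \<in> topspace Y \<and> Y closure_of (f ` elts a) = Y closure_of {y})"
  have g: "g a \<in> topspace Y" "Y closure_of (f ` elts a) = Y closure_of {g a}"
    if "a \<in> topspace (XH H X)" for a
    using someI_ex[OF ex[OF that]] that by (auto simp: g_def)
  have "{a \<in> topspace (XH H X). g a \<in> V} = diamond H X {x \<in> topspace X. f x \<in> V}"
    if V: "openin Y V" for V
  proof -
    have "g a \<in> V \<longleftrightarrow> elts a \<inter> {x \<in> topspace X. f x \<in> V} \<noteq> {}" if a: "a \<in> topspace (XH H X)" for a
    proof -
      have aX: "elts a \<subseteq> topspace X"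
        using a by (simp add: topspace_XH HDc_subset)
      then have "f ` elts a \<subseteq> topspace Y"
        using continuous_map_image_subset_topspace[OF f] by blast
      then have "f ` elts a \<inter> V \<noteq> {} \<longleftrightarrow> g a \<in> V"
        using closure_eq_iff_meet_same_opens[of "f ` elts a" Y "{g a}"] g[OF a] V by auto
      then show ?thesis
        using aX by blast
    qed
    then show ?thesis
      by (auto simp: diamond_def topspace_XH)
  qed
  then have "continuous_map (XH H X) Y g"
    unfolding continuous_map openin_XH_iff[OF H]
    using g(1) openin_continuous_map_preimage[OF f] by blast
  then have "g \<in> Hom Top0 (XH H X) Y"
    by (simp add: Hom_Top0 g_def)
  moreover have "g (eta X x) = f x" if x: "x \<in> topspace X" for x
  proof -
    have e: "eta X x \<in> topspace (XH H X)"
      using elts_eta[OF X x] closure_of_singleton_in_HDc[OF x, of H] by (simp add: topspace_XH)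
    have "Y closure_of {g (eta X x)} = Y closure_of {f x}"
      using g(2)[OF e] elts_eta[OF X x] closure_of_image_closure_of[OF f, of "{x}"] x by simp
    moreover have "f x \<in> topspace Y"
      using x continuous_map_image_subset_topspace[OF f] by blast
    ultimately show ?thesis
      using Y0 g(1)[OF e] t0_closure_of_singleton_inject[of Y] by (simp add: Obj_Top0)
  qed
  ultimately show ?thesis
    using g by blast
qed

text \<open>A closed set \<open>\<A>\<close> of the reflection consists of the members of \<open>HDc H X\<close> that are subsets of
  \<open>B = \<eta>\<^sup>-\<^sup>1(\<A>)\<close>. If \<open>\<A>\<close> is determined, then so is \<open>B\<close>, since the extension of \<open>f\<close> to the reflection
  sends \<open>\<A>\<close> to a set with the same closure as \<open>f(B)\<close>; hence \<open>B\<close> is itself a point of the reflection, and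
  it is generic in \<open>\<A>\<close>.\<close>

lemma XH_super_H_sober:
  fixes H :: "'u::grothendieck_universe subset_system"
  assumes H: "R_subset_system H" "property_M H" and X: "X \<in> Obj Top0"
  shows "super_H_sober H (XH H X)"
proof (rule super_H_soberI[OF H XH_in_Top0[OF H(1) X]])
  fix \<A> assume \<A>: "\<A> \<in> HDc H (XH H X)"
  then have closed: "closedin (XH H X) \<A>" and det: "super_H_sober_determined H (XH H X) \<A>"
    by (auto simp: HDc_def)
  have \<A>_sub: "\<A> \<subseteq> topspace (XH H X)"
    by (rule HDc_subset[OF \<A>])
  obtain U where U: "openin X U" "topspace (XH H X) - \<A> = diamond H X U"
    using closed openin_XH_iff[OF H(1)] unfolding closedin_def by metis
  define B where "B = topspace X - U"
  have \<A>_iff: "a \<in> \<A> \<longleftrightarrow> elts a \<subseteq> B" if a: "a \<in> topspace (XH H X)" for a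
  proof -
    have "a \<in> \<A> \<longleftrightarrow> a \<notin> diamond H X U"
      using U(2) a by blast
    then show ?thesis
      using a HDc_subset[of "elts a" H X] by (auto simp: B_def topspace_XH diamond_def)
  qed
  have eta: "eta X x \<in> \<A>" if "x \<in> B" for x
  proof -
    have x: "x \<in> topspace X"
      using that by (simp add: B_def)
    have "eta X x \<in> topspace (XH H X)"
      using elts_eta[OF X x] closure_of_singleton_in_HDc[OF x, of H] by (simp add: topspace_XH)
    moreover have "eta X x \<notin> diamond H X U"
      using eta_in_diamond_iff[OF X x U(1), of H] that by (simp add: B_def)
    ultimately show ?thesis
      using U(2) by blast
  qed
  have "super_H_sober_determined H X B"
  proof (rule super_H_sober_determinedI)
    show BX: "B \<subseteq> topspace X"
      by (simp add: B_def)
    obtain a where a: "a \<in> \<A>"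
      using det by (auto simp: super_H_sober_determined_def)
    moreover have "elts a \<noteq> {}"
      using a \<A>_sub by (auto simp: topspace_XH HDc_def super_H_sober_determined_def)
    ultimately show "B \<noteq> {}"
      using \<A>_iff \<A>_sub by blast
    fix Y :: "'u topology" and f
    assume Y: "super_H_sober H Y" and f: "continuous_map X Y f"
    obtain g where g: "g \<in> Hom Top0 (XH H X) Y" "\<And>x. x \<in> topspace X \<Longrightarrow> g (eta X x) = f x"
      "\<And>a. a \<in> topspace (XH H X) \<Longrightarrow>
        g a \<in> topspace Y \<and> Y closure_of (f ` elts a) = Y closure_of {g a}"
      using XH_lift_exists[OF H(1) X Y f] by blast
    obtain y where y: "y \<in> topspace Y" "Y closure_of (g ` \<A>) = Y closure_of {y}"
      using det Y g(1) unfolding super_H_sober_determined_def Hom_Top0 by blast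
    have "Y closure_of (f ` B) = Y closure_of (g ` \<A>)"
    proof (rule antisym)
      show "Y closure_of (f ` B) \<subseteq> Y closure_of (g ` \<A>)"
      proof (intro closure_of_mono image_subsetI)
        fix x assume "x \<in> B"
        then show "f x \<in> g ` \<A>"
          using eta[of x] g(2)[of x] BX by (metis image_eqI subsetD)
      qed
      show "Y closure_of (g ` \<A>) \<subseteq> Y closure_of (f ` B)"
      proof (intro closure_of_minimal image_subsetI)
        fix a assume a: "a \<in> \<A>"
        then have "g a \<in> Y closure_of (f ` elts a)"
          using g(3)[of a] \<A>_sub closure_of_subset[of "{g a}" Y] by auto
        then show "g a \<in> Y closure_of (f ` B)"
          using closure_of_mono[of "f ` elts a" "f ` B" Y] \<A>_iff[of a] a \<A>_sub by blast
      qed simp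
    qed
    then show "\<exists>y\<in>topspace Y. Y closure_of (f ` B) = Y closure_of {y}"
      using y by auto
  qed
  then have B: "B \<in> HDc H X"
    using closedin_diff[OF closedin_topspace U(1)] by (simp add: HDc_def B_def)
  define b where "b = as_elt B"
  have b: "elts b = B" "b \<in> topspace (XH H X)"
    using elts_as_elt_HDc[OF X B] B by (simp_all add: b_def topspace_XH)
  have "\<A> = XH H X closure_of {b}"
  proof (rule antisym)
    show "XH H X closure_of {b} \<subseteq> \<A>"
      using \<A>_iff[OF b(2)] b(1) closed by (intro closure_of_minimal) auto
    show "\<A> \<subseteq> XH H X closure_of {b}"
    proof
      fix a assume a: "a \<in> \<A>"
      then have "elts a \<subseteq> B"
        using \<A>_iff \<A>_sub by blast
      then show "a \<in> XH H X closure_of {b}"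
        unfolding in_closure_of openin_XH_iff[OF H(1)]
        using a \<A>_sub b B by (auto simp: diamond_def)
    qed
  qed
  then show "\<exists>b\<in>topspace (XH H X). \<A> = XH H X closure_of {b}"
    using b(2) by blast
qed

lemma XH_lift_unique:
  assumes H: "R_subset_system H" and X: "X \<in> Obj Top0" and Y: "super_H_sober H Y"
    and f: "f \<in> Hom Top0 X Y"
  shows "\<exists>!g. g \<in> Hom Top0 (XH H X) Y \<and> compose (topspace X) g (eta X) = f"
proof (rule ex_ex1I)
  obtain g where g: "g \<in> Hom Top0 (XH H X) Y" "\<forall>x\<in>topspace X. g (eta X x) = f x"
    using XH_lift_exists[OF H X Y, of f] f by (auto simp: Hom_Top0)
  have "compose (topspace X) g (eta X) = f"
    using f g(2) by (intro extensionalityI[of _ "topspace X"]) (auto simp: Hom_Top0 compose_def)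
  then show "\<exists>g. g \<in> Hom Top0 (XH H X) Y \<and> compose (topspace X) g (eta X) = f"
    using g(1) by blast
next
  fix g h assume gh: "g \<in> Hom Top0 (XH H X) Y \<and> compose (topspace X) g (eta X) = f"
    "h \<in> Hom Top0 (XH H X) Y \<and> compose (topspace X) h (eta X) = f"
  have "Y \<in> Obj Top0"
    using Y by (simp add: super_H_sober_def)
  moreover have "g (eta X x) = h (eta X x)" if "x \<in> topspace X" for x
    using gh that by (metis compose_eq)
  ultimately show "g = h"
    using XH_hom_eqI[OF H X] gh by blast
qed


section \<open>The reflector as a functor\<close>

lemma compose_in_Hom:
  fixes X Y Z :: "'u::grothendieck_universe topology"
  assumes "f \<in> Hom Top0 X Y" and "g \<in> Hom Top0 Y Z"
  shows "compose (topspace X) g f \<in> Hom Top0 X Z"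
proof -
  have "continuous_map X Z (compose (topspace X) g f)"
    by (rule continuous_map_eq[OF continuous_map_compose[of X Y f Z g]])
      (use assms in \<open>auto simp: Hom_Top0 compose_def\<close>)
  then show ?thesis
    by (simp add: Hom_Top0 compose_def)
qed

lemma compose_assoc_Hom:
  assumes "f \<in> Hom Top0 X Y"
  shows "compose (topspace X) h (compose (topspace X) g f) =
    compose (topspace X) (compose (topspace Y) h g) f"
proof (rule ext)
  fix x
  have "x \<in> topspace X \<Longrightarrow> f x \<in> topspace Y"
    using assms by (auto simp: Hom_Top0 continuous_map_def)
  then show "compose (topspace X) h (compose (topspace X) g f) x =
      compose (topspace X) (compose (topspace Y) h g) f x"
    by (simp add: compose_def)
qed

lemma HS_arrow_unique:
  assumes H: "R_subset_system H" "property_M H" and X: "X \<in> Obj Top0" and Y: "Y \<in> Obj Top0"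
    and f: "f \<in> Hom Top0 X Y"
  shows "\<exists>!g. g \<in> Hom Top0 (XH H X) (XH H Y) \<and>
    compose (topspace X) g (eta X) = compose (topspace X) (eta Y) f"
  by (intro XH_lift_unique H X XH_super_H_sober Y compose_in_Hom[OF f] eta_in_Hom)

lemma HS_arrow:
  assumes "R_subset_system H" "property_M H" "X \<in> Obj Top0" "Y \<in> Obj Top0" "f \<in> Hom Top0 X Y"
  shows "farr (HS H) X Y f \<in> Hom Top0 (XH H X) (XH H Y)"
    and "compose (topspace X) (farr (HS H) X Y f) (eta X) = compose (topspace X) (eta Y) f"
  using theI'[OF HS_arrow_unique[OF assms]] by (simp_all add: HS_def Comp_Top0)

lemma HS_arrow_eqI:
  assumes "R_subset_system H" "property_M H" "X \<in> Obj Top0" "Y \<in> Obj Top0" "f \<in> Hom Top0 X Y"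
    and "g \<in> Hom Top0 (XH H X) (XH H Y)"
    and "compose (topspace X) g (eta X) = compose (topspace X) (eta Y) f"
  shows "farr (HS H) X Y f = g"
  using HS_arrow_unique[OF assms(1-5)] HS_arrow[OF assms(1-5)] assms(6,7) by blast

text \<open>The map \<open>A \<mapsto> cl f(A)\<close> pulls \<open>\<diamond>V\<close> back to \<open>\<diamond>f\<^sup>-\<^sup>1(V)\<close> and sends \<open>\<eta>(x)\<close> to \<open>\<eta>(f(x))\<close>, so uniqueness
  identifies it with the arrow part of the functor.\<close>

lemma HS_arrow_apply:
  assumes H: "R_subset_system H" "property_M H" and X: "X \<in> Obj Top0" and Y: "Y \<in> Obj Top0"
    and f: "f \<in> Hom Top0 X Y" and A: "A \<in> HDc H X"
  shows "farr (HS H) X Y f (as_elt A) = as_elt (Y closure_of (f ` A))"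
proof -
  have cont: "continuous_map X Y f"
    using f by (simp add: Hom_Top0)
  define g where "g = (\<lambda>a\<in>topspace (XH H X). as_elt (Y closure_of (f ` elts a)))"
  have cl: "Y closure_of (f ` elts a) \<in> HDc H Y" if "a \<in> topspace (XH H X)" for a
    using that closure_of_image_in_HDc[OF cont] by (simp add: topspace_XH HDc_def)
  have g: "elts (g a) = Y closure_of (f ` elts a)" if "a \<in> topspace (XH H X)" for a
    using elts_as_elt_HDc[OF Y cl[OF that]] that by (simp add: g_def)
  have pre: "{a \<in> topspace (XH H X). elts (g a) \<inter> V \<noteq> {}} =
      diamond H X {x \<in> topspace X. f x \<in> V}" if V: "openin Y V" for V
  proof -
    have "elts (g a) \<inter> V \<noteq> {} \<longleftrightarrow> elts a \<inter> {x \<in> topspace X. f x \<in> V} \<noteq> {}"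
      if a: "a \<in> topspace (XH H X)" for a
    proof -
      have "elts a \<subseteq> topspace X"
        using a by (simp add: topspace_XH HDc_subset)
      moreover have "V \<inter> Y closure_of (f ` elts a) = {} \<longleftrightarrow> V \<inter> f ` elts a = {}"
        by (rule openin_Int_closure_of_eq_empty[OF V])
      ultimately show ?thesis
        unfolding g[OF a] by blast
    qed
    then show ?thesis
      by (auto simp: diamond_def topspace_XH)
  qed
  have "continuous_map (XH H X) (XH H Y) g"
    unfolding continuous_map_XH_iff[OF H(1)]
  proof (intro conjI ballI allI impI)
    show "elts (g a) \<in> HDc H Y" if "a \<in> topspace (XH H X)" for a
      using g[OF that] cl[OF that] by simp
    fix V assume V: "openin Y V"
    show "openin (XH H X) {a \<in> topspace (XH H X). elts (g a) \<inter> V \<noteq> {}}"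
      unfolding pre[OF V] openin_XH_iff[OF H(1)]
      using openin_continuous_map_preimage[OF cont V] by blast
  qed
  then have gHom: "g \<in> Hom Top0 (XH H X) (XH H Y)"
    by (simp add: Hom_Top0 g_def)
  have "compose (topspace X) g (eta X) = compose (topspace X) (eta Y) f"
  proof (rule extensionalityI)
    fix x assume x: "x \<in> topspace X"
    have fx: "f x \<in> topspace Y"
      using x continuous_map_image_subset_topspace[OF cont] by blast
    have e: "eta X x \<in> topspace (XH H X)"
      using elts_eta[OF X x] closure_of_singleton_in_HDc[OF x, of H] by (simp add: topspace_XH)
    have "elts (g (eta X x)) = elts (eta Y (f x))"
      using g[OF e] elts_eta[OF X x] elts_eta[OF Y fx] x
        closure_of_image_closure_of[OF cont, of "{x}"] by simp
    then show "compose (topspace X) g (eta X) x = compose (topspace X) (eta Y) f x"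
      using x by (simp add: compose_def elts_eq_iff)
  qed (rule compose_extensional)+
  then have "farr (HS H) X Y f = g"
    by (rule HS_arrow_eqI[OF H X Y f gHom])
  moreover have "as_elt A \<in> topspace (XH H X)" "elts (as_elt A) = A"
    using elts_as_elt_HDc[OF X A] A by (simp_all add: topspace_XH)
  ultimately show ?thesis
    by (simp add: g_def)
qed

lemma category_full_on:
  assumes "category C" and "P \<subseteq> Obj C"
  shows "category (C\<lparr>Obj := P\<rparr>)"
  using assms unfolding category_def by (simp add: subset_iff)

lemma full_subcategory_full_on:
  assumes "category C" and "P \<subseteq> Q" and "Q \<subseteq> Obj C"
  shows "full_subcategory (C\<lparr>Obj := P\<rparr>) (C\<lparr>Obj := Q\<rparr>)"
  using assms category_full_on[of C P] category_full_on[of C Q]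
  by (simp add: full_subcategory_def)

lemma is_functor_inclusion:
  assumes "full_subcategory D C"
  shows "is_functor D C inclusion"
  using assms unfolding full_subcategory_def is_functor_def inclusion_def
  by (simp add: subset_iff)

text \<open>Discarding objects of \<open>C\<close> outside \<open>D\<close> changes no hom-set, so the bijections of the adjunction
  remain those of \<open>C\<close>.\<close>

lemma left_adjoint_inclusion_restrict:
  assumes adj: "left_adjoint C D F inclusion"
    and P: "Obj D \<subseteq> P" "P \<subseteq> Obj C" and full: "full_subcategory D (C\<lparr>Obj := P\<rparr>)"
  shows "left_adjoint (C\<lparr>Obj := P\<rparr>) D F inclusion"
proof -
  have "is_functor (C\<lparr>Obj := P\<rparr>) D F"
    using adj P category_full_on[of C P] unfolding left_adjoint_def is_functor_def
    by (simp add: subset_iff)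
  moreover have "is_functor D (C\<lparr>Obj := P\<rparr>) inclusion"
    by (rule is_functor_inclusion[OF full])
  ultimately show ?thesis
    using adj P unfolding left_adjoint_def by (simp add: subset_iff) metis
qed

lemma is_functor_HS:
  fixes H :: "'u::grothendieck_universe subset_system"
  assumes H: "R_subset_system H" "property_M H"
  shows "is_functor Top0 (SH_Sob H) (HS H)"
  unfolding is_functor_def
proof (intro conjI ballI)
  show "category (Top0 :: ('u topology, 'u \<Rightarrow> 'u) cat)"
    by (rule category_Top0)
  show "category (SH_Sob H)"
    unfolding SH_Sob_def
    by (rule category_full_on[OF category_Top0]) (auto simp: super_H_sober_def)
  show "fobj (HS H) X \<in> Obj (SH_Sob H)" if "X \<in> Obj Top0" for X
    using XH_super_H_sober[OF H that] by (simp add: HS_def SH_Sob_def)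
  show "farr (HS H) X Y f \<in> Hom (SH_Sob H) (fobj (HS H) X) (fobj (HS H) Y)"
    if "X \<in> Obj Top0" "Y \<in> Obj Top0" "f \<in> Hom Top0 X Y" for X Y f
    using HS_arrow(1)[OF H that] by (simp add: HS_def SH_Sob_def)
  show "farr (HS H) X X (Ident Top0 X) = Ident (SH_Sob H) (fobj (HS H) X)"
    if X: "X \<in> Obj Top0" for X
  proof -
    have IX: "Ident Top0 X \<in> Hom Top0 X X"
      using category_Top0 X unfolding category_def by blast
    have IXH: "Ident Top0 (XH H X) \<in> Hom Top0 (XH H X) (XH H X)"
      using category_Top0 XH_in_Top0[OF H(1) X] unfolding category_def by blast
    have "eta X x \<in> topspace (XH H X)" if "x \<in> topspace X" for x
      using eta_in_Hom[OF H(1) X] that by (auto simp: Hom_Top0 continuous_map_def)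
    then have "compose (topspace X) (Ident Top0 (XH H X)) (eta X) =
        compose (topspace X) (eta X) (Ident Top0 X)"
      by (simp add: Top0_def compose_def fun_eq_iff)
    from HS_arrow_eqI[OF H X X IX IXH this] show ?thesis
      by (simp add: HS_def SH_Sob_def)
  qed
  show "farr (HS H) X Z (Comp Top0 X Y Z g f) =
      Comp (SH_Sob H) (fobj (HS H) X) (fobj (HS H) Y) (fobj (HS H) Z)
        (farr (HS H) Y Z g) (farr (HS H) X Y f)"
    if X: "X \<in> Obj Top0" and Y: "Y \<in> Obj Top0" and Z: "Z \<in> Obj Top0"
      and f: "f \<in> Hom Top0 X Y" and g: "g \<in> Hom Top0 Y Z" for X Y Z f g
  proof -
    let ?Ff = "farr (HS H) X Y f" and ?Fg = "farr (HS H) Y Z g"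
    note Ff = HS_arrow[OF H X Y f] and Fg = HS_arrow[OF H Y Z g]
    have "compose (topspace X) (compose (topspace (XH H X)) ?Fg ?Ff) (eta X) =
        compose (topspace X) ?Fg (compose (topspace X) ?Ff (eta X))"
      by (rule compose_assoc_Hom[OF eta_in_Hom[OF H(1) X], symmetric])
    also have "\<dots> = compose (topspace X) ?Fg (compose (topspace X) (eta Y) f)"
      by (simp add: Ff(2))
    also have "\<dots> = compose (topspace X) (compose (topspace Y) ?Fg (eta Y)) f"
      by (rule compose_assoc_Hom[OF f])
    also have "\<dots> = compose (topspace X) (compose (topspace Y) (eta Z) g) f"
      by (simp add: Fg(2))
    also have "\<dots> = compose (topspace X) (eta Z) (compose (topspace X) g f)"
      by (rule compose_assoc_Hom[OF f, symmetric])
    finally have "farr (HS H) X Z (compose (topspace X) g f) =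
        compose (topspace (XH H X)) ?Fg ?Ff"
      by (rule HS_arrow_eqI[OF H X Z compose_in_Hom[OF f g] compose_in_Hom[OF Ff(1) Fg(1)]])
    then show ?thesis
      by (simp add: Comp_Top0 SH_Sob_def HS_def)
  qed
qed

text \<open>The bijection of hom-sets is composition with the unit \<open>\<eta>\<close>; it is natural because \<open>\<eta>\<close> is.\<close>

lemma left_adjoint_HS:
  fixes H :: "'u::grothendieck_universe subset_system"
  assumes H: "R_subset_system H" "property_M H"
  shows "left_adjoint Top0 (SH_Sob H) (HS H) inclusion"
proof -
  have "full_subcategory (SH_Sob H) (Top0\<lparr>Obj := Obj Top0\<rparr>)"
    unfolding SH_Sob_def
    by (rule full_subcategory_full_on[OF category_Top0]) (auto simp: super_H_sober_def)
  then have incl: "is_functor (SH_Sob H) Top0 inclusion"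
    by (simp add: is_functor_inclusion)
  define \<phi> where "\<phi> = (\<lambda>(X :: 'u topology) (Y :: 'u topology) (g :: 'u \<Rightarrow> 'u). compose (topspace X) g (eta X))"
  have "bij_betw (\<phi> X Y) (Hom Top0 (XH H X) Y) (Hom Top0 X Y)"
    if X: "X \<in> Obj Top0" and Y: "super_H_sober H Y" for X Y
  proof (rule bij_betwI')
    have \<phi>: "\<phi> X Y g \<in> Hom Top0 X Y" if "g \<in> Hom Top0 (XH H X) Y" for g
      unfolding \<phi>_def by (rule compose_in_Hom[OF eta_in_Hom[OF H(1) X] that])
    then show "\<phi> X Y g \<in> Hom Top0 X Y" if "g \<in> Hom Top0 (XH H X) Y" for g
      using that .
    show "\<phi> X Y g = \<phi> X Y h \<longleftrightarrow> g = h"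
      if "g \<in> Hom Top0 (XH H X) Y" "h \<in> Hom Top0 (XH H X) Y" for g h
      using XH_lift_unique[OF H(1) X Y \<phi>[OF that(1)]] that unfolding \<phi>_def by metis
    show "\<exists>g\<in>Hom Top0 (XH H X) Y. f = \<phi> X Y g" if "f \<in> Hom Top0 X Y" for f
      using XH_lift_unique[OF H(1) X Y that] unfolding \<phi>_def by metis
  qed
  moreover have "compose (topspace X') (compose (topspace (XH H X')) k
        (compose (topspace (XH H X')) g (farr (HS H) X' X h))) (eta X') =
      compose (topspace X') k (compose (topspace X') (compose (topspace X) g (eta X)) h)"
    if X: "X \<in> Obj Top0" and X': "X' \<in> Obj Top0" and h: "h \<in> Hom Top0 X' X" for X X' g h k
  proof -
    note e = eta_in_Hom[OF H(1) X']
    show ?thesis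
      unfolding compose_assoc_Hom[OF e, symmetric] HS_arrow(2)[OF H X' X h]
        compose_assoc_Hom[OF h] ..
  qed
  moreover have "fobj (HS H) = XH H"
    by (simp add: HS_def)
  ultimately show ?thesis
    unfolding left_adjoint_def
    using is_functor_HS[OF H] incl
    by (intro conjI exI[of _ \<phi>]) (auto simp: inclusion_def SH_Sob_def Comp_Top0 \<phi>_def)
qed

theorem corollary7p23:
  fixes H :: "'u::grothendieck_universe subset_system"
  assumes "R_subset_system H"
    and "property_M H"
  shows "reflective (SH_Sob H) Top0 \<and>
    reflective (SH_Sob H) (H_Sob H) \<and>
    left_adjoint Top0 (SH_Sob H) (HS H) inclusion \<and>
    (\<forall>X\<in>Obj Top0. fobj (HS H) X = XH H X \<and> XH H X = P_H X (HDc H X)) \<and>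
    (\<forall>X\<in>Obj Top0. \<forall>Y\<in>Obj Top0. \<forall>f\<in>Hom Top0 X Y.
      (\<exists>!g. g \<in> Hom Top0 (XH H X) (XH H Y) \<and>
        Comp Top0 X (XH H X) (XH H Y) g (eta X) = Comp Top0 X Y (XH H Y) (eta Y) f) \<and>
      farr (HS H) X Y f \<in> Hom Top0 (XH H X) (XH H Y) \<and>
      Comp Top0 X (XH H X) (XH H Y) (farr (HS H) X Y f) (eta X) =
        Comp Top0 X Y (XH H Y) (eta Y) f \<and>
      (\<forall>A\<in>HDc H X. farr (HS H) X Y f (as_elt A) = as_elt (Y closure_of (f ` A))))"
proof -
  have sub: "{X. super_H_sober H X} \<subseteq> {X. H_sober H X}" "{X. H_sober H X} \<subseteq> Obj Top0"
    using super_H_sober_imp_H_sober[OF assms(1)] by (auto simp: H_sober_def)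
  have full_Top0: "full_subcategory (SH_Sob H) Top0"
    using full_subcategory_full_on[OF category_Top0 subset_trans[OF sub] order_refl]
    by (simp add: SH_Sob_def)
  have full_H_Sob: "full_subcategory (SH_Sob H) (H_Sob H)"
    unfolding SH_Sob_def H_Sob_def by (rule full_subcategory_full_on[OF category_Top0 sub])
  note adj = left_adjoint_HS[OF assms]
  have "left_adjoint (H_Sob H) (SH_Sob H) (HS H) inclusion"
    using left_adjoint_inclusion_restrict[OF adj _ sub(2)] sub full_H_Sob
    by (simp add: H_Sob_def SH_Sob_def)
  then have "reflective (SH_Sob H) (H_Sob H)" "reflective (SH_Sob H) Top0"
    using adj full_Top0 full_H_Sob by (auto simp: reflective_def)
  then show ?thesis
    using adj HS_arrow_unique[OF assms] HS_arrow[OF assms] HS_arrow_apply[OF assms]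
    by (simp add: Comp_Top0 HS_def XH_def)
qed

end
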